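(* Let $T\in\mathcal{L}(\mathcal{H})$ be an $n$-hypercontraction, $n\ge1$. If there exists $\mathcal{M}\in Lat(T)$ such that $T|_{\mathcal{M}}\in B_1(\mathbb{D})$ and $$\mathcal{K}_{T|_{\mathcal{M}}}(\omega)=\frac{-n}{(1-|\omega|^2)^2}\quad\text{for every }\omega\in\mathbb{D},$$ then $T$ is reducible.
   Context: $\mathcal{H}$ is a complex separable infinite-dimensional Hilbert space and $\mathcal{L}(\mathcal{H})$ the bounded linear operators on it. $T$ is an $n$-hypercontraction ($n$-hypercontractive) if $\sum_{j=0}^{k}(-1)^j\binom{k}{j}T^{*j}T^j\ge0$ for every $1\le k\le n$. $Lat(T)$ is the set of closed $T$-invariant subspaces. $T$ is reducible if it has a nontrivial reducing subspace (a closed subspace other than $\{0\}$ and $\mathcal{H}$ invariant under both $T$ and $T^*$). $B_1(\mathbb{D})$ is the set of bounded operators $S$ on a Hilbert space such that for all $\omega\in\mathbb{D}$, $S-\omega$ is surjective and $\dim\ker(S-\omega)=1$, and the closed linear span of $\bigcup_{\omega\in\mathbb{D}}\ker(S-\omega)$ is the whole space. For $S\in B_1(\mathbb{D})$ and a non-vanishing holomorphic $\gamma$ with $\gamma(\omega)\in\ker(S-\omega)$, the curvature is $\mathcal{K}_S(\omega)=-\frac{\partial^2}{\partial\omega\,\partial\overline{\omega}}\log\|\gamma(\omega)\|^2$ (independent of the choice of $\gamma$).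
   Formalization: The invariant subspace M is required to be proper (M ≠ H); for M = H the claim is false, e.g. the backward shift on the Hardy space (n = 1) satisfies all hypotheses but is irreducible, as is every operator in B_1(D). *)

theory Defs
  imports "HOL-Analysis.Analysis"
begin

section \<open>Complex Hilbert spaces\<close>

text \<open>
  The inner product is linear in the first argument. The last axiom says that the norm is the
  one given by the inner product; positive definiteness follows from it and the norm axioms.
\<close>

class complex_inner = real_normed_vector +
  fixes scaleC :: "complex \<Rightarrow> 'a \<Rightarrow> 'a" (infixr \<open>*\<^sub>C\<close> 75)
    and cinner :: "'a \<Rightarrow> 'a \<Rightarrow> complex"
  assumes scaleC_add_right: "a *\<^sub>C (x + y) = a *\<^sub>C x + a *\<^sub>C y"
    and scaleC_add_left: "(a + b) *\<^sub>C x = a *\<^sub>C x + b *\<^sub>C x"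
    and scaleC_scaleC: "a *\<^sub>C (b *\<^sub>C x) = (a * b) *\<^sub>C x"
    and scaleR_scaleC: "scaleR r x = complex_of_real r *\<^sub>C x"
    and cinner_commute: "cinner x y = cnj (cinner y x)"
    and cinner_add_left: "cinner (x + y) z = cinner x z + cinner y z"
    and cinner_scaleC_left: "cinner (a *\<^sub>C x) y = a * cinner x y"
    and cinner_self: "cinner x x = complex_of_real ((norm x)\<^sup>2)"

class chilbert_space = complex_inner + banach

lemma scaleC_one: "1 *\<^sub>C x = (x :: 'a::complex_inner)"
  using scaleR_scaleC[of 1 x] by simp

global_interpretation cvec: vector_space "scaleC :: complex \<Rightarrow> 'a \<Rightarrow> 'a::complex_inner"
  by unfold_locales (simp_all add: scaleC_add_right scaleC_add_left scaleC_scaleC scaleC_one)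


section \<open>Operators and subspaces\<close>

text \<open>
  A Hilbert space is represented as a closed complex subspace \<open>M\<close> of a type of class
  \<^class>\<open>chilbert_space\<close> (all of it for \<open>M = UNIV\<close>), and an operator on it as a function of which
  only the values on \<open>M\<close> matter. Hence the restriction of \<open>T\<close> to an invariant subspace \<open>M\<close> is
  \<open>T\<close> itself, regarded as an operator on \<open>M\<close>.
\<close>

definition closed_csubspace :: "'a::complex_inner set \<Rightarrow> bool" where
  "closed_csubspace M \<longleftrightarrow> cvec.subspace M \<and> closed M"

definition bounded_operator_on :: "'a::complex_inner set \<Rightarrow> ('a \<Rightarrow> 'a) \<Rightarrow> bool" where
  "bounded_operator_on M S \<longleftrightarrow>
     S ` M \<subseteq> M \<and>
     (\<forall>x\<in>M. \<forall>y\<in>M. S (x + y) = S x + S y) \<and>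
     (\<forall>c. \<forall>x\<in>M. S (c *\<^sub>C x) = c *\<^sub>C S x) \<and>
     (\<exists>B. \<forall>x\<in>M. norm (S x) \<le> B * norm x)"

definition Lat :: "('a::complex_inner \<Rightarrow> 'a) \<Rightarrow> 'a set set" where
  "Lat T = {M. closed_csubspace M \<and> T ` M \<subseteq> M}"

definition cadjoint :: "('a::complex_inner \<Rightarrow> 'a) \<Rightarrow> 'a \<Rightarrow> 'a" where
  "cadjoint T = (SOME S. \<forall>x y. cinner (T x) y = cinner x (S y))"

definition positive_operator :: "('a::complex_inner \<Rightarrow> 'a) \<Rightarrow> bool" where
  "positive_operator A \<longleftrightarrow> (\<forall>x. cinner (A x) x \<in> \<real>\<^sub>\<ge>\<^sub>0)"

definition hypercontraction :: "nat \<Rightarrow> ('a::complex_inner \<Rightarrow> 'a) \<Rightarrow> bool" where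
  "hypercontraction n T \<longleftrightarrow>
     (\<forall>k\<in>{1..n}. positive_operator
       (\<lambda>x. \<Sum>j=0..k. ((-1) ^ j * of_nat (k choose j)) *\<^sub>C (cadjoint T ^^ j) ((T ^^ j) x)))"

definition reducible :: "('a::complex_inner \<Rightarrow> 'a) \<Rightarrow> bool" where
  "reducible T \<longleftrightarrow>
     (\<exists>N. closed_csubspace N \<and> N \<noteq> {0} \<and> N \<noteq> UNIV \<and> T ` N \<subseteq> N \<and> cadjoint T ` N \<subseteq> N)"


section \<open>The class \<open>B\<^sub>1(\<bbbD>)\<close> and the curvature\<close>

definition eigenspace :: "'a::complex_inner set \<Rightarrow> ('a \<Rightarrow> 'a) \<Rightarrow> complex \<Rightarrow> 'a set" where
  "eigenspace M S \<omega> = {x\<in>M. S x - \<omega> *\<^sub>C x = 0}"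

definition cowen_douglas_B1 :: "'a::complex_inner set \<Rightarrow> ('a \<Rightarrow> 'a) \<Rightarrow> bool" where
  "cowen_douglas_B1 M S \<longleftrightarrow>
     closed_csubspace M \<and> bounded_operator_on M S \<and>
     (\<forall>\<omega>\<in>ball 0 1. (\<lambda>x. S x - \<omega> *\<^sub>C x) ` M = M \<and> cvec.dim (eigenspace M S \<omega>) = 1) \<and>
     closure (cvec.span (\<Union>\<omega>\<in>ball 0 1. eigenspace M S \<omega>)) = M"

definition vector_holomorphic_on :: "(complex \<Rightarrow> 'a::complex_inner) \<Rightarrow> complex set \<Rightarrow> bool" where
  "vector_holomorphic_on \<gamma> U \<longleftrightarrow>
     (\<forall>z\<in>U. \<exists>v. (\<gamma> has_derivative (\<lambda>h. h *\<^sub>C v)) (at z within U))"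

definition holomorphic_frame ::
    "'a::complex_inner set \<Rightarrow> ('a \<Rightarrow> 'a) \<Rightarrow> complex set \<Rightarrow> (complex \<Rightarrow> 'a) \<Rightarrow> bool" where
  "holomorphic_frame M S U \<gamma> \<longleftrightarrow>
     vector_holomorphic_on \<gamma> U \<and> (\<forall>z\<in>U. \<gamma> z \<in> eigenspace M S z \<and> \<gamma> z \<noteq> 0)"

definition wirtinger_d :: "(complex \<Rightarrow> complex) \<Rightarrow> complex \<Rightarrow> complex" where
  "wirtinger_d f z =
     (vector_derivative (\<lambda>t. f (z + of_real t)) (at 0)
      - \<i> * vector_derivative (\<lambda>t. f (z + \<i> * of_real t)) (at 0)) / 2"

definition wirtinger_dbar :: "(complex \<Rightarrow> complex) \<Rightarrow> complex \<Rightarrow> complex" where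
  "wirtinger_dbar f z =
     (vector_derivative (\<lambda>t. f (z + of_real t)) (at 0)
      + \<i> * vector_derivative (\<lambda>t. f (z + \<i> * of_real t)) (at 0)) / 2"

text \<open>
  For \<open>S \<in> B\<^sub>1(\<bbbD>)\<close> the value below does not depend on the frame \<open>\<gamma>\<close>. Since it depends
  only on the germ of \<open>\<gamma>\<close> at \<open>\<omega>\<close>, frames on any open neighbourhood of \<open>\<omega>\<close> in the disc are
  admitted; frames on the whole disc are the case \<open>U = ball 0 1\<close>.
\<close>

definition curvature :: "'a::complex_inner set \<Rightarrow> ('a \<Rightarrow> 'a) \<Rightarrow> complex \<Rightarrow> complex" where
  "curvature M S \<omega> =
     (THE c. \<exists>U \<gamma>. open U \<and> \<omega> \<in> U \<and> U \<subseteq> ball 0 1 \<and> holomorphic_frame M S U \<gamma> \<and>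
        c = - wirtinger_d (wirtinger_dbar (\<lambda>z. of_real (ln ((norm (\<gamma> z))\<^sup>2)))) \<omega>)"

end

theory Submission
  imports Defs "HOL-Complex_Analysis.Complex_Analysis"
begin

text \<open>
  Write \<open>Q(x, y) = \<Sum>\<^sub>j (-1)\<^sup>j (n choose j) \<langle>T\<^sup>j x, T\<^sup>j y\<rangle>\<close> for the positive semidefinite defect form of order
  \<open>n\<close>. For a holomorphic frame \<open>\<gamma>\<close> of eigenvectors in \<open>M\<close>, the curvature condition says exactly that
  the Gram determinant of \<open>\<gamma>\<close>, \<open>\<gamma>'\<close> with respect to \<open>Q\<close> vanishes. By the equality case of
  Cauchy-Schwarz, \<open>Q(\<gamma>', \<cdot>)\<close> is then a multiple of \<open>Q(\<gamma>, \<cdot>)\<close>, so that locally, and by connectedness on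
  the whole disc, all eigenvectors have proportional \<open>Q(u, \<cdot>)\<close>, namely \<open>Q(u, \<cdot>) = c \<langle>e, \<cdot>\<rangle>\<close> for
  \<open>e\<close> spanning the kernel of \<open>T\<close> in \<open>M\<close>. Since \<open>T u = w u\<close> and \<open>T\<close> is a contraction, this can be
  solved for the inner product: \<open>\<langle>u, x\<rangle> = c \<Sum>\<^sub>i b\<^sub>i w\<^sup>i \<langle>e, T\<^sup>i x\<rangle>\<close> with the positive Taylor coefficients
  \<open>b\<^sub>i\<close> of \<open>(1 - t)\<^sup>-\<^sup>n\<close>. If \<open>x\<close> is orthogonal to \<open>M\<close>, the left side vanishes for all \<open>w\<close>, hence
  \<open>\<langle>e, T\<^sup>i x\<rangle> = 0\<close> for all \<open>i\<close>, and the expansion of \<open>\<langle>u, T x\<rangle>\<close> vanishes too. So the orthogonal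
  complement of \<open>M\<close> is invariant under \<open>T\<close> as well as under its adjoint.
\<close>

section \<open>Hilbert space preliminaries\<close>

lemma cinner_add_right: "cinner x (y + z) = cinner x y + cinner x (z::'a::complex_inner)"
  by (metis cinner_add_left cinner_commute complex_cnj_add)

lemma cinner_scaleC_right: "cinner x (a *\<^sub>C y) = cnj a * cinner x (y::'a::complex_inner)"
  by (metis cinner_scaleC_left cinner_commute complex_cnj_mult)

lemma cinner_zero_left [simp]: "cinner 0 (x::'a::complex_inner) = 0"
  using cinner_add_left[of 0 0 x] by simp

lemma cinner_zero_right [simp]: "cinner (x::'a::complex_inner) 0 = 0"
  using cinner_add_right[of x 0 0] by simp

lemma cinner_minus_left: "cinner (- x) (y::'a::complex_inner) = - cinner x y"
  using cinner_add_left[of x "-x" y] by (simp add: add_eq_0_iff)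

lemma cinner_minus_right: "cinner x (- y) = - cinner x (y::'a::complex_inner)"
  using cinner_add_right[of x y "-y"] by (simp add: add_eq_0_iff)

lemma cinner_diff_left: "cinner (x - y) (z::'a::complex_inner) = cinner x z - cinner y z"
  using cinner_add_left[of x "-y" z] by (simp add: cinner_minus_left)

lemma cinner_diff_right: "cinner z (x - y) = cinner z x - cinner z (y::'a::complex_inner)"
  using cinner_add_right[of z x "-y"] by (simp add: cinner_minus_right)

lemma cinner_sum_left: "cinner (sum f A) (y::'a::complex_inner) = (\<Sum>i\<in>A. cinner (f i) y)"
  by (induction A rule: infinite_finite_induct) (auto simp: cinner_add_left)

lemmas cinner_simps = cinner_add_left cinner_add_right cinner_diff_left cinner_diff_right
  cinner_scaleC_left cinner_scaleC_right

lemma Re_cinner_self: "Re (cinner x x) = (norm (x::'a::complex_inner))\<^sup>2"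
  by (simp add: cinner_self)

lemma cinner_self_eq_0 [simp]: "cinner x x = 0 \<longleftrightarrow> x = (0::'a::complex_inner)"
  by (simp add: cinner_self)

lemma norm_scaleC: "norm (a *\<^sub>C (x::'a::complex_inner)) = cmod a * norm x"
proof -
  have "complex_of_real ((norm (a *\<^sub>C x))\<^sup>2) = (a * cnj a) * cinner x x"
    unfolding cinner_self[symmetric] by (simp add: cinner_scaleC_left cinner_scaleC_right)
  also have "\<dots> = complex_of_real ((cmod a * norm x)\<^sup>2)"
    unfolding cinner_self complex_norm_square[symmetric] by (simp add: power_mult_distrib)
  finally have "(norm (a *\<^sub>C x))\<^sup>2 = (cmod a * norm x)\<^sup>2"
    by (simp only: of_real_eq_iff)
  then show ?thesis
    by (simp add: power2_eq_iff_nonneg)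
qed

lemma bounded_bilinear_scaleC: "bounded_bilinear (scaleC :: complex \<Rightarrow> 'a \<Rightarrow> 'a::complex_inner)"
proof
  show "\<exists>K. \<forall>a (x::'a). norm (a *\<^sub>C x) \<le> norm a * norm x * K"
    by (intro exI[of _ 1]) (simp add: norm_scaleC)
qed (simp_all add: scaleC_add_left scaleC_add_right scaleR_scaleC scaleC_scaleC
      scaleR_conv_of_real mult.commute)

subsection \<open>Positive sesquilinear forms\<close>

text \<open>Common ground of the inner product and the defect forms. It asks for semidefiniteness
  because the argument turns on null vectors of a defect form.\<close>

definition psd_form :: "('a::complex_inner \<Rightarrow> 'a \<Rightarrow> complex) \<Rightarrow> bool" where
  "psd_form q \<longleftrightarrow> (\<forall>x y z. q (x + y) z = q x z + q y z) \<and> (\<forall>a x y. q (a *\<^sub>C x) y = a * q x y) \<and>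
     (\<forall>x y. q y x = cnj (q x y)) \<and> (\<forall>x. 0 \<le> Re (q x x))"

lemma psd_formD:
  assumes "psd_form q"
  shows "q (x + y) z = q x z + q y z" "q (a *\<^sub>C x) y = a * q x y" "q y x = cnj (q x y)"
    "0 \<le> Re (q x x)"
proof -
  note * = assms[unfolded psd_form_def]
  show "q (x + y) z = q x z + q y z" by (rule *[THEN conjunct1, rule_format])
  show "q (a *\<^sub>C x) y = a * q x y" by (rule *[THEN conjunct2, THEN conjunct1, rule_format])
  show "q y x = cnj (q x y)" by (rule *[THEN conjunct2, THEN conjunct2, THEN conjunct1, rule_format])
  show "0 \<le> Re (q x x)"
    by (rule *[THEN conjunct2, THEN conjunct2, THEN conjunct2, rule_format])
qed

lemma psd_form_add_right:
  assumes "psd_form q" shows "q z (x + y) = q z x + q z y"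
  by (subst (1 2 3) psd_formD(3)[OF assms]) (simp add: psd_formD(1)[OF assms])

lemma psd_form_scaleC_right:
  assumes "psd_form q" shows "q x (a *\<^sub>C y) = cnj a * q x y"
  by (subst (1 2) psd_formD(3)[OF assms]) (simp add: psd_formD(2)[OF assms])

lemma psd_form_diff_left:
  assumes "psd_form q" shows "q (x - y) z = q x z - q y z"
  using psd_formD(1)[OF assms, of "x - y" y z] by simp

lemma psd_form_self:
  assumes "psd_form q" shows "q x x = of_real (Re (q x x))"
  using psd_formD(3)[OF assms, of x x] by (metis of_real_Re Reals_cnj_iff)

text \<open>Evaluate the form at x + s b y with b = q x y and s real: the factor b makes the cross
  terms equal to 2 s |b|^2, so a real quadratic in s is nonnegative.\<close>

lemma psd_form_cauchy_schwarz:
  assumes "psd_form q"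
  shows "(cmod (q x y))\<^sup>2 \<le> Re (q x x) * Re (q y y)"
proof -
  note q = psd_formD[OF assms] psd_form_add_right[OF assms] psd_form_scaleC_right[OF assms]
  define b where "b = q x y"
  have b': "q y x = cnj b"
    using q(3) b_def by blast
  have ex: "0 \<le> s\<^sup>2 * (cmod b)\<^sup>2 * Re (q y y) + 2 * s * (cmod b)\<^sup>2 + Re (q x x)" for s :: real
  proof -
    have "q (x + (of_real s * b) *\<^sub>C y) (x + (of_real s * b) *\<^sub>C y)
        = q x x + 2 * of_real s * (b * cnj b) + (of_real s)\<^sup>2 * (b * cnj b) * q y y"
      by (simp add: q(1,2) q(5,6) b_def[symmetric] b' algebra_simps power2_eq_square)
    also have "\<dots> = of_real (s\<^sup>2 * (cmod b)\<^sup>2 * Re (q y y) + 2 * s * (cmod b)\<^sup>2 + Re (q x x))"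
      unfolding complex_norm_square[symmetric]
      by (subst psd_form_self[OF assms, of x], subst psd_form_self[OF assms, of y]) simp
    finally show ?thesis
      using q(4)[of "x + (of_real s * b) *\<^sub>C y"] by simp
  qed
  show ?thesis
  proof (cases "Re (q y y) = 0")
    case True
    have "cmod b = 0"
    proof (rule ccontr)
      assume nz: "cmod b \<noteq> 0"
      \<comment> \<open>With q y y = 0 the quadratic is affine in s, and this s gives it the value
        -1.\<close>
      have "0 \<le> 2 * (- (Re (q x x) + 1) / (2 * (cmod b)\<^sup>2)) * (cmod b)\<^sup>2 + Re (q x x)"
        using ex[of "- (Re (q x x) + 1) / (2 * (cmod b)\<^sup>2)"] True by simp
      also have "\<dots> = -1"
        using nz by (simp add: field_simps)
      finally show False by simp
    qed
    then show ?thesis using True b_def by simp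
  next
    case False
    then have p: "Re (q y y) > 0"
      using q(4)[of y] by simp
    \<comment> \<open>Here s = -1 / q y y is the minimiser of the quadratic.\<close>
    have "0 \<le> (1 / Re (q y y))\<^sup>2 * (cmod b)\<^sup>2 * Re (q y y) - 2 * (1 / Re (q y y)) * (cmod b)\<^sup>2 + Re (q x x)"
      using ex[of "- 1 / Re (q y y)"] by simp
    then show ?thesis
      using p unfolding b_def[symmetric] by (simp add: field_simps power2_eq_square)
  qed
qed

text \<open>Null vectors lie in the radical of the form, since Cauchy-Schwarz bounds |q u x|^2 by
  zero.\<close>

lemma psd_form_kernel:
  assumes "psd_form q" "q u u = 0"
  shows "q u x = 0"
  using psd_form_cauchy_schwarz[OF assms(1), of u x] assms(2) by simp

lemma psd_form_cinner: "psd_form (cinner :: 'a \<Rightarrow> 'a::complex_inner \<Rightarrow> complex)"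
  unfolding psd_form_def
  by (auto simp: cinner_add_left cinner_scaleC_left Re_cinner_self intro: cinner_commute)

lemma cinner_cauchy_schwarz: "cmod (cinner x y) \<le> norm x * norm (y::'a::complex_inner)"
proof -
  have "(cmod (cinner x y))\<^sup>2 \<le> (norm x * norm y)\<^sup>2"
    using psd_form_cauchy_schwarz[OF psd_form_cinner, of x y]
    by (simp add: Re_cinner_self power_mult_distrib)
  then show ?thesis
    by (rule power2_le_imp_le) simp
qed

lemma bounded_bilinear_cinner:
  "bounded_bilinear (cinner :: 'a \<Rightarrow> 'a::complex_inner \<Rightarrow> complex)"
proof
  show "\<exists>K. \<forall>(x::'a) y. norm (cinner x y) \<le> norm x * norm y * K"
    by (intro exI[of _ 1]) (simp add: cinner_cauchy_schwarz)
qed (simp_all add: cinner_simps scaleR_scaleC scaleR_conv_of_real)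

subsection \<open>Orthogonal complements and adjoints\<close>

lemma parallelogram:
  "(norm (x + y))\<^sup>2 + (norm (x - y))\<^sup>2 = 2 * (norm x)\<^sup>2 + 2 * (norm (y::'a::complex_inner))\<^sup>2"
  unfolding Re_cinner_self[symmetric] by (simp add: cinner_simps)

lemma closed_csubspaceD:
  assumes "closed_csubspace M"
  shows "0 \<in> M" "x \<in> M \<Longrightarrow> y \<in> M \<Longrightarrow> x + y \<in> M" "x \<in> M \<Longrightarrow> a *\<^sub>C x \<in> M"
    "x \<in> M \<Longrightarrow> y \<in> M \<Longrightarrow> x - y \<in> M" "closed M"
  using assms unfolding closed_csubspace_def
  by (auto simp: cvec.subspace_0 cvec.subspace_add cvec.subspace_scale cvec.subspace_diff)

text \<open>The parallelogram law forces a minimising sequence to be Cauchy, and M is closed in a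
  complete space.\<close>

lemma nearest_point_exists:
  fixes M :: "'a::chilbert_space set"
  assumes M: "closed_csubspace M"
  shows "\<exists>p\<in>M. \<forall>m\<in>M. norm (x - p) \<le> norm (x - m)"
proof -
  define d where "d = (INF m\<in>M. norm (x - m))"
  have ne: "M \<noteq> {}" using closed_csubspaceD(1)[OF M] by blast
  have bdd: "bdd_below ((\<lambda>m. norm (x - m)) ` M)"
    by (rule bdd_belowI[of _ 0]) auto
  have d: "d \<le> norm (x - m)" if "m \<in> M" for m
    unfolding d_def using bdd that by (rule cINF_lower)
  have d0: "0 \<le> d"
    unfolding d_def using ne by (intro cINF_greatest) auto
  have "\<exists>m\<in>M. norm (x - m) < d + 1 / Suc n" for n
  proof -
    have "(INF m\<in>M. norm (x - m)) < d + 1 / Suc n"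
      unfolding d_def[symmetric] by simp
    then show ?thesis
      using cINF_less_iff[OF ne bdd] by blast
  qed
  then obtain p where p: "\<And>n. p n \<in> M" "\<And>n. norm (x - p n) < d + 1 / Suc n"
    by metis
  have lim: "(\<lambda>n. norm (x - p n)) \<longlonglongrightarrow> d"
  proof (rule tendsto_sandwich[of "\<lambda>_. d" _ _ "\<lambda>n. d + 1 / Suc n"])
    show "(\<lambda>n. d + 1 / Suc n) \<longlonglongrightarrow> d"
      using tendsto_add[OF tendsto_const[of d] LIMSEQ_inverse_real_of_nat]
      by (simp add: inverse_eq_divide)
    show "\<forall>\<^sub>F n in sequentially. norm (x - p n) \<le> d + 1 / Suc n"
      using p(2) by (intro always_eventually) (auto intro: less_imp_le)
  qed (use d p(1) in auto)
  have key: "(norm (p m - p n))\<^sup>2 \<le> 2 * (norm (x - p m))\<^sup>2 + 2 * (norm (x - p n))\<^sup>2 - 4 * d\<^sup>2" for m n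
  proof -
    \<comment> \<open>The midpoint lies in M, so its distance from x is at least d; this bounds the
      sum term of the parallelogram law from below.\<close>
    have mid: "(1/2) *\<^sub>R (p m + p n) \<in> M"
      unfolding scaleR_scaleC using closed_csubspaceD(2,3)[OF M] p(1) by blast
    have "(x - p m) + (x - p n) = 2 *\<^sub>R (x - (1/2) *\<^sub>R (p m + p n))"
      by (simp add: algebra_simps scaleR_2)
    then have "norm ((x - p m) + (x - p n)) = 2 * norm (x - (1/2) *\<^sub>R (p m + p n))"
      by simp
    then have "2 * d \<le> norm ((x - p m) + (x - p n))"
      using d[OF mid] by simp
    then have "(2 * d)\<^sup>2 \<le> (norm ((x - p m) + (x - p n)))\<^sup>2"
      using d0 by (intro power_mono) auto
    then show ?thesis
      using parallelogram[of "x - p m" "x - p n"]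
      by (simp add: norm_minus_commute power_mult_distrib)
  qed
  have "Cauchy p"
  proof (rule CauchyI)
    fix e :: real assume e: "e > 0"
    have "(\<lambda>n. (norm (x - p n))\<^sup>2) \<longlonglongrightarrow> d\<^sup>2"
      using lim by (rule tendsto_power)
    then have "\<forall>\<^sub>F n in sequentially. (norm (x - p n))\<^sup>2 < d\<^sup>2 + e\<^sup>2 / 4"
      by (rule order_tendstoD) (use e in simp)
    then obtain N where N: "\<And>n. n \<ge> N \<Longrightarrow> (norm (x - p n))\<^sup>2 < d\<^sup>2 + e\<^sup>2 / 4"
      unfolding eventually_sequentially by blast
    have "norm (p m - p n) < e" if "m \<ge> N" "n \<ge> N" for m n
    proof -
      have "(norm (p m - p n))\<^sup>2 < e\<^sup>2"
        using key[of m n] N[OF that(1)] N[OF that(2)] by simp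
      then show ?thesis
        using e by (simp add: power_less_imp_less_base)
    qed
    then show "\<exists>N. \<forall>m\<ge>N. \<forall>n\<ge>N. norm (p m - p n) < e" by blast
  qed
  then obtain q where q: "p \<longlonglongrightarrow> q"
    by (metis Cauchy_convergent_iff convergentD)
  have "q \<in> M"
    using closed_csubspaceD(5)[OF M] p(1) q by (metis closed_sequentially)
  moreover have "norm (x - q) = d"
    using LIMSEQ_unique[OF tendsto_norm[OF tendsto_diff[OF tendsto_const q]] lim] .
  ultimately show ?thesis
    using d by auto
qed

text \<open>Take y to be x minus its nearest point in M. The clause \<open>x - y \<in> M\<close>
  keeps this decomposition available for \<open>riesz_representation\<close>.\<close>

lemma orthogonal_vector_exists:
  fixes M :: "'a::chilbert_space set"
  assumes M: "closed_csubspace M" and "x \<notin> M"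
  shows "\<exists>y. y \<noteq> 0 \<and> x - y \<in> M \<and> (\<forall>m\<in>M. cinner m y = 0)"
proof -
  obtain p where p: "p \<in> M" "\<And>m. m \<in> M \<Longrightarrow> norm (x - p) \<le> norm (x - m)"
    using nearest_point_exists[OF M] by blast
  define y where "y = x - p"
  have "cinner m y = 0" if m: "m \<in> M" for m
  proof (cases "m = 0")
    case False
    \<comment> \<open>The projection coefficient of y on m. Minimality says that removing
      \<open>a *\<^sub>C m\<close> does not shorten y, Pythagoras says that it does unless a =
      0.\<close>
    define a where "a = cinner y m / cinner m m"
    have nz: "cinner m m \<noteq> 0" using False by simp
    have orth: "cinner (y - a *\<^sub>C m) m = 0"
      using nz by (simp add: cinner_simps a_def)
    have "norm y \<le> norm (y - a *\<^sub>C m)"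
      using p(2)[of "p + a *\<^sub>C m"] closed_csubspaceD(2,3)[OF M] p(1) m
      by (simp add: y_def algebra_simps)
    then have "(norm y)\<^sup>2 \<le> (norm (y - a *\<^sub>C m))\<^sup>2"
      by (simp add: power_mono)
    moreover have "(norm y)\<^sup>2 = (norm (y - a *\<^sub>C m))\<^sup>2 + (norm (a *\<^sub>C m))\<^sup>2"
    proof -
      have o2: "cinner m (y - a *\<^sub>C m) = 0"
        using orth cinner_commute complex_cnj_zero by metis
      have "cinner y y = cinner ((y - a *\<^sub>C m) + a *\<^sub>C m) ((y - a *\<^sub>C m) + a *\<^sub>C m)"
        by simp
      also have "\<dots> = cinner (y - a *\<^sub>C m) (y - a *\<^sub>C m) + cinner (a *\<^sub>C m) (a *\<^sub>C m)"
        by (simp only: cinner_add_left cinner_add_right cinner_scaleC_left cinner_scaleC_right orth o2)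
           simp
      finally show ?thesis
        unfolding Re_cinner_self[symmetric] by simp
    qed
    ultimately have "norm (a *\<^sub>C m) = 0" by simp
    then have "a = 0" using False by (simp add: norm_scaleC)
    then have "cinner y m = 0" using nz by (simp add: a_def)
    then show ?thesis by (metis cinner_commute complex_cnj_zero)
  qed simp
  moreover have "y \<noteq> 0" using assms(2) p(1) y_def by auto
  ultimately show ?thesis using p(1) by (intro exI[of _ y]) (auto simp: y_def)
qed

text \<open>The kernel of a nonzero f is a closed hyperplane. Modulo the kernel each x is a multiple
  of a vector y orthogonal to it, so pairing with y recovers f x up to a constant.\<close>

lemma riesz_representation:
  fixes f :: "'a::chilbert_space \<Rightarrow> complex"
  assumes f: "bounded_linear f" and fC: "\<And>a x. f (a *\<^sub>C x) = a * f x"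
  shows "\<exists>y. \<forall>x. f x = cinner x y"
proof (cases "\<forall>x. f x = 0")
  case True
  then show ?thesis by (intro exI[of _ 0]) simp
next
  case False
  interpret bounded_linear f by fact
  from False obtain x0 where x0: "f x0 \<noteq> 0" by blast
  define K where "K = {x. f x = 0}"
  have "closed K"
    unfolding K_def by (intro closed_Collect_eq continuous_intros linear_continuous_on f)
  then have K: "closed_csubspace K"
    unfolding closed_csubspace_def K_def by (auto simp: cvec.subspace_def fC zero add)
  obtain y where y: "y \<noteq> 0" "x0 - y \<in> K" "\<And>m. m \<in> K \<Longrightarrow> cinner m y = 0"
    using orthogonal_vector_exists[OF K, of x0] x0 by (auto simp: K_def)
  have fy: "f y = f x0" using y(2) by (simp add: K_def diff)
  have nz: "cinner y y \<noteq> 0" using y(1) by simp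
  \<comment> \<open>The conjugate appears because \<open>cinner\<close> is antilinear in its second
    slot.\<close>
  have "f x = cinner x ((cnj (f y) / cinner y y) *\<^sub>C y)" for x
  proof -
    have "x - (f x / f y) *\<^sub>C y \<in> K"
      using x0 fy by (simp add: K_def diff fC)
    then have "cinner x y = f x / f y * cinner y y"
      using y(3) by (fastforce simp: cinner_simps)
    then show ?thesis
      using nz fy x0 by (simp add: cinner_scaleC_right cinner_self)
  qed
  then show ?thesis by blast
qed

text \<open>\<open>cadjoint\<close> is defined by choice; Riesz applied to x \<mapsto> <T x, y> for
  each y shows that there is something to choose.\<close>

lemma cadjoint:
  fixes T :: "'a::chilbert_space \<Rightarrow> 'a"
  assumes T: "bounded_linear T" and TC: "\<And>a x. T (a *\<^sub>C x) = a *\<^sub>C T x"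
  shows "cinner (T x) y = cinner x (cadjoint T y)"
proof -
  have "\<exists>z. \<forall>x. cinner (T x) y = cinner x z" for y
    using bounded_linear_compose[OF bounded_bilinear.bounded_linear_left[OF bounded_bilinear_cinner] T]
    by (intro riesz_representation) (auto simp: TC cinner_scaleC_left)
  then have "\<exists>S. \<forall>x y. cinner (T x) y = cinner x (S y)"
    by metis
  then show ?thesis
    unfolding cadjoint_def by (rule someI2_ex) blast
qed

section \<open>Existence of holomorphic frames\<close>

subsection \<open>The open mapping theorem\<close>

text \<open>The Baire half of the open mapping theorem: N is the union of the closures of the images
  of balls, so one of them has interior relative to N. Closures yield approximate preimages
  only.\<close>

lemma surjective_bounded_preimages_dense:
  fixes A :: "'a::real_normed_vector \<Rightarrow> 'b::banach"
  assumes A: "bounded_linear A" and M: "subspace M" and N: "subspace N" "closed N"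
    and AM: "A ` M = N"
  shows "\<exists>K\<ge>0. \<forall>y\<in>N. \<forall>\<delta>>0. \<exists>x\<in>M. norm x \<le> K * norm y \<and> norm (y - A x) < \<delta>"
proof -
  interpret A: bounded_linear A by fact
  define E where "E n = closure (A ` (M \<inter> cball 0 (real n)))" for n
  have EN: "E n \<subseteq> N" for n
    unfolding E_def using AM N(2) by (intro closure_minimal) auto
  have cov: "(\<Union>n. E n) = N"
  proof
    show "N \<subseteq> (\<Union>n. E n)"
    proof
      fix y assume "y \<in> N"
      then obtain x where x: "x \<in> M" "y = A x" using AM by blast
      obtain n where "norm x \<le> real n" using real_arch_simple by blast
      then show "y \<in> (\<Union>n. E n)"
        unfolding E_def using x closure_subset by fastforce
    qed
  qed (use EN in blast)
  have "\<exists>n. top_of_set N interior_of E n \<noteq> {}"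
  proof (rule ccontr)
    assume "\<not> ?thesis"
    then have "top_of_set N interior_of \<Union>(range E) = {}"
      using EN N(2) by (intro Baire_category_alt)
        (auto simp: completely_metrizable_space_euclidean completely_metrizable_space_closedin
           closedin_closed_eq E_def)
    \<comment> \<open>N is its own relative interior and contains 0, so it cannot be a countable
      union of closed sets without interior.\<close>
    moreover have "top_of_set N interior_of N = N"
      by (metis interior_of_topspace topspace_euclidean_subtopology)
    moreover have "0 \<in> N" using N(1) by (rule subspace_0)
    ultimately show False using cov by simp
  qed
  then obtain n y0 where "y0 \<in> top_of_set N interior_of E n" by blast
  then obtain U where U: "openin (top_of_set N) U" "y0 \<in> U" "U \<subseteq> E n"
    unfolding interior_of_def by blast
  then obtain e where e: "e > 0" "ball y0 e \<inter> N \<subseteq> E n"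
    unfolding openin_contains_ball by blast
  have y0: "y0 \<in> N" using U EN by blast
  have approx: "\<exists>x\<in>M. norm x \<le> real n \<and> norm (y - A x) < \<delta>" if "y \<in> E n" "\<delta> > 0" for y \<delta>
  proof -
    have "\<exists>z\<in>A ` (M \<inter> cball 0 (real n)). dist z y < \<delta>"
      using that unfolding E_def closure_approachable by blast
    then show ?thesis by (auto simp: dist_norm norm_minus_commute)
  qed
  \<comment> \<open>Subtracting approximate preimages of y0 + y and of y0 moves the ball from y0 to
    the origin.\<close>
  have small: "\<exists>x\<in>M. norm x \<le> 2 * real n \<and> norm (y - A x) < \<delta>"
    if y: "y \<in> N" "norm y < e" and d: "\<delta> > 0" for y \<delta>
  proof -
    have "y0 + y \<in> E n" "y0 \<in> E n"
      using e y y0 subspace_add[OF N(1) y0 y(1)] by (auto simp: dist_norm intro!: subsetD[OF e(2)])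
    then obtain x1 x2 where x: "x1 \<in> M" "norm x1 \<le> real n" "norm (y0 + y - A x1) < \<delta> / 2"
       "x2 \<in> M" "norm x2 \<le> real n" "norm (y0 - A x2) < \<delta> / 2"
      using approx[of _ "\<delta> / 2"] d by (metis half_gt_zero)
    have "norm (x1 - x2) \<le> 2 * real n"
      using norm_triangle_ineq4[of x1 x2] x by simp
    moreover have "y - A (x1 - x2) = (y0 + y - A x1) - (y0 - A x2)"
      by (simp add: A.diff)
    then have "norm (y - A (x1 - x2)) < \<delta>"
      using norm_triangle_ineq4[of "y0 + y - A x1" "y0 - A x2"] x(3,6) by (simp only:)
    ultimately show ?thesis
      using subspace_diff[OF M x(1,4)] by (intro bexI[of _ "x1 - x2"] conjI)
  qed
  show ?thesis
  proof (intro exI[of _ "4 * real n / e"] conjI ballI allI impI)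
    show "0 \<le> 4 * real n / e" using e by simp
    fix y and \<delta> :: real assume y: "y \<in> N" and d: "\<delta> > 0"
    show "\<exists>x\<in>M. norm x \<le> 4 * real n / e * norm y \<and> norm (y - A x) < \<delta>"
    proof (cases "y = 0")
      case True
      then show ?thesis
        using d subspace_0[OF M] by (intro bexI[of _ 0]) auto
    next
      case False
      \<comment> \<open>Scales y to norm e / 2. Undoing the scaling turns the bound 2 n into 4 n / e
        times the norm of y.\<close>
      define c where "c = e / (2 * norm y)"
      have c: "c > 0" using False e by (simp add: c_def)
      have "norm (c *\<^sub>R y) < e" using False e by (simp add: c_def)
      then obtain x where x: "x \<in> M" "norm x \<le> 2 * real n" "norm (c *\<^sub>R y - A x) < c * \<delta>"
        using small[of "c *\<^sub>R y" "c * \<delta>"] subspace_scale[OF N(1) y] c d by auto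
      have "c *\<^sub>R y - A x = c *\<^sub>R (y - A ((1/c) *\<^sub>R x))"
        using c by (simp add: A.scaleR algebra_simps)
      then have "norm (y - A ((1/c) *\<^sub>R x)) < \<delta>"
        using x(3) c by simp
      moreover have "norm ((1/c) *\<^sub>R x) \<le> 4 * real n / e * norm y"
        using x(2) c False e by (simp add: c_def field_simps)
      ultimately show ?thesis
        using subspace_scale[OF M x(1)] by blast
    qed
  qed
qed

lemma surjective_bounded_preimages:
  fixes A :: "'a::banach \<Rightarrow> 'b::banach"
  assumes A: "bounded_linear A" and M: "subspace M" "closed M" and N: "subspace N" "closed N"
    and AM: "A ` M = N"
  shows "\<exists>C>0. \<forall>y\<in>N. \<exists>x\<in>M. A x = y \<and> norm x \<le> C * norm y"
proof -
  interpret A: bounded_linear A by fact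
  obtain K where K: "K \<ge> 0"
    "\<And>y \<delta>. y \<in> N \<Longrightarrow> \<delta> > 0 \<Longrightarrow> \<exists>x\<in>M. norm x \<le> K * norm y \<and> norm (y - A x) < \<delta>"
    using surjective_bounded_preimages_dense[OF A M(1) N AM] by blast
  \<comment> \<open>The geometric series gives 2 K; adding 1 keeps the constant positive when K =
    0.\<close>
  have "\<exists>x\<in>M. A x = y \<and> norm x \<le> (2 * K + 1) * norm y" if y: "y \<in> N" for y
  proof (cases "y = 0")
    case True
    then show ?thesis
      using subspace_0[OF M(1)] by (intro bexI[of _ 0]) (auto simp: A.zero)
  next
    case False
    define s where "s k = norm y / 2 ^ k" for k :: nat
    have s: "s k > 0" for k using False by (simp add: s_def)
    \<comment> \<open>The state \<open>f k\<close> is a pair of the latest correction and the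
      remaining residual; the first component of \<open>f 0\<close> is a dummy.\<close>
    have "\<exists>f. \<forall>k. (snd (f k) \<in> N \<and> norm (snd (f k)) \<le> s k \<and> (k = 0 \<longrightarrow> snd (f k) = y)) \<and>
       (fst (f (Suc k)) \<in> M \<and> norm (fst (f (Suc k))) \<le> K * s k \<and>
         snd (f (Suc k)) = snd (f k) - A (fst (f (Suc k))))"
    proof (rule dependent_nat_choice)
      show "\<exists>x :: 'a \<times> 'b. snd x \<in> N \<and> norm (snd x) \<le> s 0 \<and> ((0::nat) = 0 \<longrightarrow> snd x = y)"
        using y by (intro exI[of _ "(0, y)"]) (simp add: s_def)
      fix p :: "'a \<times> 'b" and k :: nat
      assume p: "snd p \<in> N \<and> norm (snd p) \<le> s k \<and> (k = 0 \<longrightarrow> snd p = y)"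
      obtain x where x: "x \<in> M" "norm x \<le> K * norm (snd p)" "norm (snd p - A x) < s (Suc k)"
        using K(2)[of "snd p" "s (Suc k)"] p s by blast
      have "snd p - A x \<in> N"
        using p x(1) AM by (intro subspace_diff[OF N(1)]) auto
      moreover have "norm x \<le> K * s k"
        using x(2) p K(1) by (meson mult_left_mono order_trans)
      ultimately show "\<exists>q. (snd q \<in> N \<and> norm (snd q) \<le> s (Suc k) \<and> (Suc k = 0 \<longrightarrow> snd q = y)) \<and>
          fst q \<in> M \<and> norm (fst q) \<le> K * s k \<and> snd q = snd p - A (fst q)"
        using x by (intro exI[of _ "(x, snd p - A x)"]) simp
    qed
    then obtain f where f: "\<And>k. norm (snd (f k)) \<le> s k" "snd (f 0) = y"
        "\<And>k. fst (f (Suc k)) \<in> M" "\<And>k. norm (fst (f (Suc k))) \<le> K * s k"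
        "\<And>k. snd (f (Suc k)) = snd (f k) - A (fst (f (Suc k)))"
      by blast
    define x where "x k = fst (f (Suc k))" for k
    have ssums: "(\<lambda>k. K * s k) sums (2 * K * norm y)"
      using sums_mult[OF power_half_series, of "2 * K * norm y"]
      by (simp add: s_def power_divide field_simps)
    have sx: "summable (\<lambda>k. norm (x k))"
      using f(4) by (intro summable_comparison_test'[OF sums_summable[OF ssums]]) (simp add: x_def)
    then have sx': "x sums suminf x"
      using summable_norm_cancel summable_sums by blast
    have part: "A (\<Sum>k<n. x k) = y - snd (f n)" for n
    proof (induction n)
      case (Suc n)
      then show ?case using f(5)[of n] by (simp add: A.add x_def)
    qed (simp add: A.zero f(2))
    have "(\<lambda>n. y - snd (f n)) \<longlonglongrightarrow> A (suminf x)"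
      using A.tendsto[OF sx'[unfolded sums_def]] by (simp add: part)
    moreover have "s \<longlonglongrightarrow> 0"
      using tendsto_mult[OF tendsto_const[of "norm y"] LIMSEQ_realpow_zero[of "1/2"]]
      by (simp add: s_def[abs_def] power_divide)
    then have "(\<lambda>n. snd (f n)) \<longlonglongrightarrow> 0"
      by (rule Lim_null_comparison[rotated]) (use f(1) in auto)
    then have "(\<lambda>n. y - snd (f n)) \<longlonglongrightarrow> y"
      using tendsto_diff[OF tendsto_const[of y]] by fastforce
    ultimately have "A (suminf x) = y"
      using LIMSEQ_unique by blast
    moreover have "(\<Sum>k<n. x k) \<in> M" for n
      using f(3) by (intro subspace_sum[OF M(1)]) (simp add: x_def)
    then have "suminf x \<in> M"
      using sx' M(2) unfolding sums_def by (metis closed_sequentially)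
    moreover have "norm (suminf x) \<le> 2 * K * norm y"
      using summable_norm[OF sx] suminf_le[OF _ sx sums_summable[OF ssums]] f(4)
      by (simp add: x_def[abs_def] sums_unique[OF ssums, symmetric])
    then have "norm (suminf x) \<le> (2 * K + 1) * norm y"
      by (simp add: distrib_right add_increasing2)
    ultimately show ?thesis by blast
  qed
  then show ?thesis
    using K(1) by (intro exI[of _ "2 * K + 1"]) auto
qed

subsection \<open>Vector-valued power series\<close>

lemma summable_vector_powser:
  fixes v :: "nat \<Rightarrow> 'a::chilbert_space"
  assumes v: "\<And>k. norm (v k) \<le> K * C ^ k" and C: "C > 0" and z: "cmod z < 1 / C"
  shows "summable (\<lambda>k. z ^ k *\<^sub>C v k)"
proof (rule summable_comparison_test')
  show "summable (\<lambda>k. K * (C * cmod z) ^ k)"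
    using C z by (intro summable_mult summable_geometric) (simp add: field_simps)
  show "norm (z ^ k *\<^sub>C v k) \<le> K * (C * cmod z) ^ k" for k
    using mult_left_mono[OF v[of k], of "cmod z ^ k"]
    by (simp add: norm_scaleC norm_power power_mult_distrib mult_ac)
qed

text \<open>Termwise differentiation, justified by uniform convergence of the derived series. The
  radius 1 / (4 C) pays for the crude bound i \<le> 2^i and still leaves the ratio 1/2.\<close>

lemma vector_powser_has_derivative:
  fixes v :: "nat \<Rightarrow> 'a::chilbert_space"
  assumes v: "\<And>k. norm (v k) \<le> K * C ^ k" and C: "C > 0" and K: "K \<ge> 0"
    and z: "cmod z < 1 / (4 * C)"
  shows "((\<lambda>z. \<Sum>k. z ^ k *\<^sub>C v k) has_derivative
           (\<lambda>h. h *\<^sub>C (\<Sum>k. z ^ k *\<^sub>C (of_nat (Suc k) *\<^sub>C v (Suc k))))) (at z)"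
proof -
  define S where "S = ball (0::complex) (1 / (4 * C))"
  have small: "cmod x < 1 / C" if "x \<in> S" for x
    using that C by (auto simp: S_def field_simps)
  interpret sc: bounded_bilinear "scaleC :: complex \<Rightarrow> 'a \<Rightarrow> 'a"
    by (rule bounded_bilinear_scaleC)
  define d where "d i x = (of_nat i * x ^ (i - 1)) *\<^sub>C v i" for i and x :: complex
  define G where "G x = (\<Sum>i. d i x)" for x
  have dbound: "norm (d i x) \<le> 4 * K * C * (1/2) ^ i" if "x \<in> S" for i x
  proof (cases i)
    case (Suc j)
    have "norm (d i x) = real i * (cmod x ^ j * norm (v i))"
      by (simp add: d_def norm_scaleC norm_mult norm_power Suc del: of_nat_Suc)
    also have "\<dots> \<le> 2 ^ i * ((1 / (4 * C)) ^ j * (K * C ^ i))"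
    proof -
      have "cmod x ^ j \<le> (1 / (4 * C)) ^ j"
        using that by (intro power_mono) (auto simp: S_def)
      moreover have "real i \<le> 2 ^ i"
        by (metis less_exp of_nat_mono of_nat_numeral of_nat_power less_imp_le)
      ultimately show ?thesis
        using v[of i] C K by (intro mult_mono) auto
    qed
    also have "\<dots> = 2 * K * C * (1/2) ^ j"
    proof -
      have "(4::real) ^ j = 2 ^ j * 2 ^ j" by (simp flip: power_mult_distrib)
      then show ?thesis
        using C by (simp add: Suc power_divide power_mult_distrib field_simps)
    qed
    also have "\<dots> = 4 * K * C * (1/2) ^ i"
      by (simp add: Suc)
    finally show ?thesis .
  qed (use K C in \<open>simp add: d_def\<close>)
  have unif: "uniform_limit S (\<lambda>n x. \<Sum>i<n. d i x) G sequentially"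
    unfolding G_def using dbound
    by (intro Weierstrass_m_test[of _ _ "\<lambda>i. 4 * K * C * (1/2) ^ i"] summable_mult
        summable_geometric) auto
  have zS: "z \<in> S" using z by (simp add: S_def)
  have "\<exists>g. \<forall>x\<in>S. (\<lambda>n. x ^ n *\<^sub>C v n) sums g x \<and> (g has_derivative (\<lambda>h. h *\<^sub>C G x)) (at x within S)"
  proof (rule has_derivative_series[where f' = "\<lambda>i x h. h *\<^sub>C d i x"])
    show "convex S" by (simp add: S_def)
    fix n x assume "x \<in> S"
    have "((\<lambda>x. x ^ n *\<^sub>C v n) has_derivative (\<lambda>h. (of_nat n * h * x ^ (n - 1)) *\<^sub>C v n)) (at x within S)"
      by (auto intro!: derivative_eq_intros bounded_linear.has_derivative[OF sc.bounded_linear_left])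
    then show "((\<lambda>x. x ^ n *\<^sub>C v n) has_derivative (\<lambda>h. h *\<^sub>C d n x)) (at x within S)"
      by (simp add: d_def scaleC_scaleC mult_ac)
  next
    fix e :: real assume "e > 0"
    then have "\<forall>\<^sub>F n in sequentially. \<forall>x\<in>S. dist (\<Sum>i<n. d i x) (G x) < e"
      using unif unfolding uniform_limit_iff by blast
    then show "\<forall>\<^sub>F n in sequentially. \<forall>x\<in>S. \<forall>h. norm ((\<Sum>i<n. h *\<^sub>C d i x) - h *\<^sub>C G x) \<le> e * norm h"
    proof (rule eventually_mono, intro ballI allI)
      fix n x and h :: complex assume *: "\<forall>x\<in>S. dist (\<Sum>i<n. d i x) (G x) < e" and x: "x \<in> S"
      have "(\<Sum>i<n. h *\<^sub>C d i x) - h *\<^sub>C G x = h *\<^sub>C ((\<Sum>i<n. d i x) - G x)"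
        by (simp add: sc.diff_right sc.sum_right)
      then show "norm ((\<Sum>i<n. h *\<^sub>C d i x) - h *\<^sub>C G x) \<le> e * norm h"
        using mult_right_mono[of "norm ((\<Sum>i<n. d i x) - G x)" e "norm h"] bspec[OF * x]
        by (simp add: norm_scaleC dist_norm mult.commute)
    qed
  next
    show "(\<lambda>n. z ^ n *\<^sub>C v n) sums (\<Sum>n. z ^ n *\<^sub>C v n)"
      using summable_vector_powser[OF v C small[OF zS]] by (rule summable_sums)
  qed (rule zS)
  then obtain g where g: "\<And>x. x \<in> S \<Longrightarrow> (\<lambda>n. x ^ n *\<^sub>C v n) sums g x"
      "\<And>x. x \<in> S \<Longrightarrow> (g has_derivative (\<lambda>h. h *\<^sub>C G x)) (at x within S)" by blast
  have "(g has_derivative (\<lambda>h. h *\<^sub>C G z)) (at z)"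
    using g(2)[OF zS] at_within_open[OF zS] by (simp add: S_def)
  then have "((\<lambda>z. \<Sum>k. z ^ k *\<^sub>C v k) has_derivative (\<lambda>h. h *\<^sub>C G z)) (at z)"
    by (rule has_derivative_transform_within_open[where s = S])
      (use zS g(1) in \<open>auto simp: S_def sums_unique\<close>)
  moreover have "G z = (\<Sum>k. z ^ k *\<^sub>C (of_nat (Suc k) *\<^sub>C v (Suc k)))"
  proof -
    have "summable (\<lambda>i. d i z)"
    proof (rule summable_comparison_test')
      show "summable (\<lambda>i. 4 * K * C * (1/2) ^ i)"
        by (intro summable_mult summable_geometric) simp
    qed (use dbound[OF zS] in blast)
    from suminf_split_head[OF this] show ?thesis
      by (simp add: G_def d_def scaleC_scaleC mult.commute)
  qed
  ultimately show ?thesis by simp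
qed

text \<open>A local eigenvector frame with two explicit derivatives, so that the curvature, which
  differentiates twice, becomes a formula in \<gamma> and \<gamma>'.\<close>

definition smooth_frame ::
    "'a::complex_inner set \<Rightarrow> ('a \<Rightarrow> 'a) \<Rightarrow> complex set \<Rightarrow>
      (complex \<Rightarrow> 'a) \<Rightarrow> (complex \<Rightarrow> 'a) \<Rightarrow> (complex \<Rightarrow> 'a) \<Rightarrow> bool" where
  "smooth_frame M S V \<gamma> \<gamma>' \<gamma>'' \<longleftrightarrow> open V \<and> V \<subseteq> ball 0 1 \<and>
     (\<forall>z\<in>V. \<gamma> z \<in> eigenspace M S z \<and> \<gamma> z \<noteq> 0 \<and>
       (\<gamma> has_derivative (\<lambda>h. h *\<^sub>C \<gamma>' z)) (at z) \<and> (\<gamma>' has_derivative (\<lambda>h. h *\<^sub>C \<gamma>'' z)) (at z))"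

lemma smooth_frameD:
  assumes "smooth_frame M S V \<gamma> \<gamma>' \<gamma>''"
  shows "open V" "V \<subseteq> ball 0 1" "z \<in> V \<Longrightarrow> \<gamma> z \<in> M" "z \<in> V \<Longrightarrow> S (\<gamma> z) = z *\<^sub>C \<gamma> z"
    "z \<in> V \<Longrightarrow> \<gamma> z \<noteq> 0" "z \<in> V \<Longrightarrow> (\<gamma> has_derivative (\<lambda>h. h *\<^sub>C \<gamma>' z)) (at z)"
    "z \<in> V \<Longrightarrow> (\<gamma>' has_derivative (\<lambda>h. h *\<^sub>C \<gamma>'' z)) (at z)"
    "z \<in> V \<Longrightarrow> \<gamma> z \<in> eigenspace M S z"
proof -
  note * = assms[unfolded smooth_frame_def]
  have **: "\<gamma> z \<in> eigenspace M S z \<and> \<gamma> z \<noteq> 0 \<and>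
       (\<gamma> has_derivative (\<lambda>h. h *\<^sub>C \<gamma>' z)) (at z) \<and> (\<gamma>' has_derivative (\<lambda>h. h *\<^sub>C \<gamma>'' z)) (at z)"
    if "z \<in> V"
    by (rule *[THEN conjunct2, THEN conjunct2, rule_format, OF that])
  show "open V" "V \<subseteq> ball 0 1"
    by (rule *[THEN conjunct1] *[THEN conjunct2, THEN conjunct1])+
  show "z \<in> V \<Longrightarrow> \<gamma> z \<in> M" "z \<in> V \<Longrightarrow> S (\<gamma> z) = z *\<^sub>C \<gamma> z"
    using **[THEN conjunct1] by (simp_all add: eigenspace_def)
  assume "z \<in> V"
  note ** = **[OF this]
  show "\<gamma> z \<in> eigenspace M S z" by (rule **[THEN conjunct1])
  show "\<gamma> z \<noteq> 0" by (rule **[THEN conjunct2, THEN conjunct1])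
  show "(\<gamma> has_derivative (\<lambda>h. h *\<^sub>C \<gamma>' z)) (at z)"
    by (rule **[THEN conjunct2, THEN conjunct2, THEN conjunct1])
  show "(\<gamma>' has_derivative (\<lambda>h. h *\<^sub>C \<gamma>'' z)) (at z)"
    by (rule **[THEN conjunct2, THEN conjunct2, THEN conjunct2])
qed

section \<open>One-dimensional eigenspaces and local frames\<close>

lemma dim_1_generator:
  assumes "cvec.dim (E :: 'a::complex_inner set) = 1"
  obtains e where "e \<in> E" "e \<noteq> 0" "\<And>x. x \<in> E \<Longrightarrow> \<exists>c. x = c *\<^sub>C e"
proof -
  obtain B where B: "B \<subseteq> E" "\<not> cvec.dependent B" "E \<subseteq> cvec.span B" "card B = cvec.dim E"
    using cvec.basis_exists by blast
  then obtain e where e: "B = {e}"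
    using assms by (metis card_1_singletonE)
  show ?thesis
  proof (rule that)
    show "e \<in> E" using B(1) e by simp
    show "e \<noteq> 0" using B(2) e by auto
    show "\<exists>c. x = c *\<^sub>C e" if "x \<in> E" for x
      using that B(3) e by (auto simp: cvec.span_singleton)
  qed
qed

lemma closed_csubspace_imp_subspace: "closed_csubspace M \<Longrightarrow> subspace M"
  by (auto simp: subspace_def closed_csubspaceD scaleR_scaleC)

text \<open>Start from e in the kernel of A = T - w and choose preimages A v(k+1) = v k with
  geometric norm growth. The series of z^k v k is then an eigenvector of A for z, hence of T for w +
  z, and equals e at z = 0.\<close>

lemma smooth_frame_exists:
  fixes T :: "'a::chilbert_space \<Rightarrow> 'a"
  assumes T: "bounded_linear T" and TC: "\<And>a x. T (a *\<^sub>C x) = a *\<^sub>C T x"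
    and B1: "cowen_douglas_B1 M T" and w: "w \<in> ball 0 1"
  shows "\<exists>r>0. \<exists>\<gamma> \<gamma>' \<gamma>''. smooth_frame M T (ball w r) \<gamma> \<gamma>' \<gamma>''"
proof -
  interpret T: bounded_linear T by fact
  interpret sc: bounded_bilinear "scaleC :: complex \<Rightarrow> 'a \<Rightarrow> 'a"
    by (rule bounded_bilinear_scaleC)
  define A where "A x = T x - w *\<^sub>C x" for x
  have A: "bounded_linear A"
    unfolding A_def by (intro bounded_linear_sub T sc.bounded_linear_right)
  interpret A: bounded_linear A by fact
  have AC: "A (a *\<^sub>C x) = a *\<^sub>C A x" for a x
    by (simp add: A_def TC sc.diff_right scaleC_scaleC mult.commute)
  have M: "closed_csubspace M" and AM: "A ` M = M" and dim: "cvec.dim (eigenspace M T w) = 1"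
    using B1 w by (auto simp: cowen_douglas_B1_def A_def[abs_def])
  obtain e where e: "e \<in> eigenspace M T w" "e \<noteq> 0"
    using dim_1_generator[OF dim] by metis
  have eM: "e \<in> M" and Ae: "A e = 0" using e(1) by (auto simp: eigenspace_def A_def)
  obtain C where C: "C > 0" "\<And>y. y \<in> M \<Longrightarrow> \<exists>x\<in>M. A x = y \<and> norm x \<le> C * norm y"
    using surjective_bounded_preimages[OF A _ _ _ _ AM] closed_csubspace_imp_subspace[OF M]
      closed_csubspaceD(5)[OF M] by blast
  have "\<exists>v. \<forall>k. (v k \<in> M \<and> norm (v k) \<le> norm e * C ^ k \<and> (k = 0 \<longrightarrow> v k = e)) \<and> A (v (Suc k)) = v k"
  proof (rule dependent_nat_choice)
    fix x k assume x: "x \<in> M \<and> norm x \<le> norm e * C ^ k \<and> (k = 0 \<longrightarrow> x = e)"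
    then obtain y where y: "y \<in> M" "A y = x" "norm y \<le> C * norm x" using C by blast
    have "norm y \<le> norm e * C ^ Suc k"
      using order_trans[OF y(3) mult_left_mono[of "norm x" "norm e * C ^ k" C]] x C(1)
      by (simp add: mult_ac)
    then show "\<exists>y. (y \<in> M \<and> norm y \<le> norm e * C ^ Suc k \<and> (Suc k = 0 \<longrightarrow> y = e)) \<and> A y = x"
      using y by blast
  qed (use eM in auto)
  then obtain v where v: "\<And>k. v k \<in> M" "\<And>k. norm (v k) \<le> norm e * C ^ k" "v 0 = e"
      "\<And>k. A (v (Suc k)) = v k"
    by blast
  \<comment> \<open>The coefficients of the first and, in the next line, of the second derivative of
    the series.\<close>
  define v1 where "v1 k = of_nat (Suc k) *\<^sub>C v (Suc k)" for k
  define v2 where "v2 k = of_nat (Suc k) *\<^sub>C v1 (Suc k)" for k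
  define P where "P v z = (\<Sum>k. z ^ k *\<^sub>C (v k :: 'a))" for v and z :: complex
  \<comment> \<open>Differentiation replaces the growth rate C by 2 C; the radius for the second
    derivative is therefore 1 / (4 (2 C)) = 1 / (8 C).\<close>
  have v1: "norm (v1 k) \<le> (norm e * C) * (2 * C) ^ k" for k
  proof -
    have "Suc k \<le> 2 ^ k" by (induction k) auto
    then have "real (Suc k) \<le> 2 ^ k"
      by (metis of_nat_le_iff of_nat_numeral of_nat_power)
    then have "real (Suc k) * norm (v (Suc k)) \<le> 2 ^ k * (norm e * C ^ Suc k)"
      using v(2)[of "Suc k"] by (rule mult_mono) auto
    then show ?thesis
      by (simp add: v1_def norm_scaleC power_mult_distrib mult_ac del: of_nat_Suc)
  qed
  have P: "(P v has_derivative (\<lambda>h. h *\<^sub>C P v1 z)) (at z)" if "cmod z < 1 / (8 * C)" for z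
    unfolding P_def[abs_def] v1_def
    by (rule vector_powser_has_derivative[OF v(2)]) (use C that in \<open>auto simp: field_simps\<close>)
  have P1: "(P v1 has_derivative (\<lambda>h. h *\<^sub>C P v2 z)) (at z)" if "cmod z < 1 / (8 * C)" for z
    unfolding P_def[abs_def] v2_def
    by (rule vector_powser_has_derivative[OF v1]) (use C that in \<open>auto simp: field_simps\<close>)
  have P0: "P v 0 = e"
    unfolding P_def by (subst suminf_finite[of "{0}"]) (auto simp: v(3) scaleC_one)
  have eig: "P v z \<in> M \<and> A (P v z) = z *\<^sub>C P v z" if z: "cmod z < 1 / (8 * C)" for z
  proof -
    have "cmod z < 1 / C" using z C by (auto simp: field_simps)
    then have sm: "summable (\<lambda>k. z ^ k *\<^sub>C v k)"
      by (intro summable_vector_powser[OF v(2) C(1)])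
    have "(\<Sum>k<n. z ^ k *\<^sub>C v k) \<in> M" for n
      using v(1) by (intro subspace_sum[OF closed_csubspace_imp_subspace[OF M]] closed_csubspaceD(3)[OF M])
    then have PM: "P v z \<in> M"
      unfolding P_def
      using closed_sequentially[OF closed_csubspaceD(5)[OF M] _ summable_sums[OF sm, unfolded sums_def]]
      by simp
    have "A (P v z) = (\<Sum>k. z ^ k *\<^sub>C A (v k))"
      unfolding P_def by (subst A.suminf[OF sm]) (simp add: AC)
    also have "\<dots> = (\<Sum>k. z ^ Suc k *\<^sub>C A (v (Suc k)))"
    proof -
      have "summable (\<lambda>k. z ^ k *\<^sub>C A (v k))"
        using A.summable[OF sm] by (simp add: AC)
      from suminf_split_head[OF this] show ?thesis by (simp add: v(3) Ae)
    qed
    also have "\<dots> = z *\<^sub>C P v z"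
      unfolding P_def
      by (subst bounded_linear.suminf[OF sc.bounded_linear_right sm]) (simp add: v(4) scaleC_scaleC)
    finally show ?thesis using PM by simp
  qed
  have "isCont (P v) 0"
    using P[of 0] C by (auto intro: has_derivative_continuous)
  then obtain r0 where r0: "r0 > 0" "\<And>z. cmod z < r0 \<Longrightarrow> P v z \<noteq> 0"
    using continuous_at_avoid[of 0 "P v" 0] e(2) P0 by (auto simp: dist_norm)
  \<comment> \<open>Three demands: the series does not vanish, both derivatives exist, and the ball
    stays in the unit disc.\<close>
  define r where "r = min (min r0 (1 / (8 * C))) (1 - cmod w)"
  have r: "r > 0" using r0 C w by (simp add: r_def)
  have shift: "((\<lambda>z. P u (z - w)) has_derivative (\<lambda>h. h *\<^sub>C d)) (at z)"
    if "(P u has_derivative (\<lambda>h. h *\<^sub>C d)) (at (z - w))" for u d z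
  proof -
    have "((\<lambda>z. z - w) has_derivative (\<lambda>h. h)) (at z)"
      by (auto intro!: derivative_eq_intros)
    from has_derivative_compose[OF this that] show ?thesis by simp
  qed
  have "smooth_frame M T (ball w r) (\<lambda>z. P v (z - w)) (\<lambda>z. P v1 (z - w)) (\<lambda>z. P v2 (z - w))"
    unfolding smooth_frame_def
  proof (intro conjI ballI)
    show "ball w r \<subseteq> ball 0 1"
    proof
      fix z assume "z \<in> ball w r"
      then have "cmod (z - w) < 1 - cmod w" by (simp add: r_def dist_norm norm_minus_commute)
      then show "z \<in> ball 0 1"
        using norm_triangle_ineq[of "z - w" w] by simp
    qed
    fix z assume "z \<in> ball w r"
    then have z: "cmod (z - w) < r" by (simp add: dist_norm norm_minus_commute)
    then have z8: "cmod (z - w) < 1 / (8 * C)" by (simp add: r_def)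
    show "P v (z - w) \<in> eigenspace M T z"
      using eig[OF z8] by (simp add: eigenspace_def A_def sc.diff_left)
    show "P v (z - w) \<noteq> 0" using z r0(2) by (simp add: r_def)
    show "((\<lambda>z. P v (z - w)) has_derivative (\<lambda>h. h *\<^sub>C P v1 (z - w))) (at z)"
      using shift P z8 by blast
    show "((\<lambda>z. P v1 (z - w)) has_derivative (\<lambda>h. h *\<^sub>C P v2 (z - w))) (at z)"
      using shift P1 z8 by blast
  qed simp
  then show ?thesis using r by blast
qed

section \<open>The curvature of a frame\<close>

text \<open>The derivatives in the directions 1 and \<i> are p + q and \<i> (p - q), from which the
  two Wirtinger combinations extract p and q.\<close>

lemma wirtinger_has_derivative:
  assumes g: "(g has_derivative (\<lambda>h. h * p + cnj h * q)) (at z)"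
  shows "wirtinger_d g z = p" "wirtinger_dbar g z = q"
proof -
  have "((\<lambda>t. z + u * of_real t) has_derivative (\<lambda>t. u * of_real t)) (at (0::real))" for u
    by (auto intro!: derivative_eq_intros)
  then have d: "((\<lambda>t. g (z + u * of_real t)) has_derivative
      (\<lambda>t. u * of_real t * p + cnj (u * of_real t) * q)) (at (0::real))" for u
    by (rule has_derivative_compose) (use g in simp)
  have "(\<lambda>t. u * of_real t * p + cnj (u * of_real t) * q) = (\<lambda>t. t *\<^sub>R (u * p + cnj u * q))" for u
    by (auto simp: scaleR_conv_of_real algebra_simps)
  with d have
    v: "vector_derivative (\<lambda>t. g (z + u * of_real t)) (at (0::real)) = u * p + cnj u * q" for u
    by (intro vector_derivative_at) (simp add: has_vector_derivative_def)
  show "wirtinger_d g z = p" "wirtinger_dbar g z = q"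
    unfolding wirtinger_d_def wirtinger_dbar_def v[of 1, simplified] v[of \<i>]
    by (simp_all add: algebra_simps)
qed

lemma has_derivative_cinner:
  assumes "(\<gamma> has_derivative (\<lambda>h. h *\<^sub>C u)) (at z)" "(\<delta> has_derivative (\<lambda>h. h *\<^sub>C v)) (at z)"
  shows "((\<lambda>z. cinner (\<gamma> z) (\<delta> z)) has_derivative
           (\<lambda>h. h * cinner u (\<delta> z) + cnj h * cinner (\<gamma> z) v)) (at z)"
  using bounded_bilinear.FDERIV[OF bounded_bilinear_cinner assms]
  by (simp add: cinner_simps add.commute)

lemma has_derivative_ln_norm:
  assumes \<gamma>: "(\<gamma> has_derivative (\<lambda>h. h *\<^sub>C u)) (at z)" and nz: "\<gamma> z \<noteq> 0"
  shows "((\<lambda>z. complex_of_real (ln ((norm (\<gamma> z))\<^sup>2))) has_derivative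
           (\<lambda>h. h * (cinner u (\<gamma> z) / cinner (\<gamma> z) (\<gamma> z)) +
                cnj h * (cinner (\<gamma> z) u / cinner (\<gamma> z) (\<gamma> z)))) (at z)"
proof -
  have c: "cinner (\<gamma> z) u = cnj (cinner u (\<gamma> z))" by (rule cinner_commute)
  have "((\<lambda>z. Re (cinner (\<gamma> z) (\<gamma> z))) has_derivative
          (\<lambda>h. Re (h * cinner u (\<gamma> z) + cnj h * cinner (\<gamma> z) u))) (at z)"
    by (intro has_derivative_Re has_derivative_cinner \<gamma>)
  then have *: "((\<lambda>z. (norm (\<gamma> z))\<^sup>2) has_derivative (\<lambda>h. 2 * Re (h * cinner u (\<gamma> z)))) (at z)"
    by (simp add: Re_cinner_self c)
  have "((\<lambda>z. ln ((norm (\<gamma> z))\<^sup>2)) has_derivative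
          (\<lambda>h. 2 * Re (h * cinner u (\<gamma> z)) * inverse ((norm (\<gamma> z))\<^sup>2))) (at z)"
    using nz by (intro has_derivative_ln[OF _ *]) simp
  then have "((\<lambda>z. complex_of_real (ln ((norm (\<gamma> z))\<^sup>2))) has_derivative
          (\<lambda>h. complex_of_real (2 * Re (h * cinner u (\<gamma> z)) * inverse ((norm (\<gamma> z))\<^sup>2)))) (at z)"
    by (rule has_derivative_of_real)
  moreover have "complex_of_real (2 * Re (h * cinner u (\<gamma> z)) * inverse ((norm (\<gamma> z))\<^sup>2)) =
      h * (cinner u (\<gamma> z) / cinner (\<gamma> z) (\<gamma> z)) + cnj h * (cinner (\<gamma> z) u / cinner (\<gamma> z) (\<gamma> z))" for h
  proof -
    have "complex_of_real (2 * Re (h * cinner u (\<gamma> z)) * inverse ((norm (\<gamma> z))\<^sup>2))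
        = complex_of_real (2 * Re (h * cinner u (\<gamma> z))) / cinner (\<gamma> z) (\<gamma> z)"
      by (simp only: of_real_mult of_real_inverse cinner_self divide_inverse)
    also have "complex_of_real (2 * Re (h * cinner u (\<gamma> z))) = h * cinner u (\<gamma> z) + cnj (h * cinner u (\<gamma> z))"
      by (rule complex_add_cnj[symmetric])
    finally show ?thesis by (simp add: c add_divide_distrib)
  qed
  ultimately show ?thesis by simp
qed

text \<open>The inner derivative is <\<gamma>, \<gamma>'> / <\<gamma>, \<gamma>>. In the quotient
  rule \<gamma>'' comes only with \<open>cnj h\<close>, so the coefficient of h is the Gram
  determinant of \<gamma>, \<gamma>' divided by <\<gamma>, \<gamma>>^2.\<close>

lemma wirtinger_ln_norm_smooth_frame:
  assumes fr: "smooth_frame M S V \<gamma> \<gamma>' \<gamma>''" and w: "w \<in> V"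
  shows "wirtinger_d (wirtinger_dbar (\<lambda>z. of_real (ln ((norm (\<gamma> z))\<^sup>2)))) w =
    (cinner (\<gamma>' w) (\<gamma>' w) * cinner (\<gamma> w) (\<gamma> w) - cinner (\<gamma>' w) (\<gamma> w) * cinner (\<gamma> w) (\<gamma>' w)) /
      (cinner (\<gamma> w) (\<gamma> w))\<^sup>2"
proof -
  note fr = smooth_frameD[OF fr]
  define f where "f = (\<lambda>z. complex_of_real (ln ((norm (\<gamma> z))\<^sup>2)))"
  have f: "wirtinger_dbar f z = cinner (\<gamma> z) (\<gamma>' z) / cinner (\<gamma> z) (\<gamma> z)" if "z \<in> V" for z
    unfolding f_def using has_derivative_ln_norm[OF fr(6,5), OF that that]
    by (rule wirtinger_has_derivative)
  have nz: "cinner (\<gamma> w) (\<gamma> w) \<noteq> 0" using fr(5)[OF w] by simp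
  have "((\<lambda>z. cinner (\<gamma> z) (\<gamma>' z) / cinner (\<gamma> z) (\<gamma> z)) has_derivative (\<lambda>h. 
      ((h * cinner (\<gamma>' w) (\<gamma>' w) + cnj h * cinner (\<gamma> w) (\<gamma>'' w)) * cinner (\<gamma> w) (\<gamma> w) -
        cinner (\<gamma> w) (\<gamma>' w) * (h * cinner (\<gamma>' w) (\<gamma> w) + cnj h * cinner (\<gamma> w) (\<gamma>' w))) /
        (cinner (\<gamma> w) (\<gamma> w) * cinner (\<gamma> w) (\<gamma> w)))) (at w)"
    by (intro has_derivative_divide' has_derivative_cinner fr(6,7) w nz)
  then have "(wirtinger_dbar f has_derivative (\<lambda>h.
      ((h * cinner (\<gamma>' w) (\<gamma>' w) + cnj h * cinner (\<gamma> w) (\<gamma>'' w)) * cinner (\<gamma> w) (\<gamma> w) -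
        cinner (\<gamma> w) (\<gamma>' w) * (h * cinner (\<gamma>' w) (\<gamma> w) + cnj h * cinner (\<gamma> w) (\<gamma>' w))) /
        (cinner (\<gamma> w) (\<gamma> w) * cinner (\<gamma> w) (\<gamma> w)))) (at w)"
    by (rule has_derivative_transform_within_open[OF _ fr(1) w]) (simp add: f)
  moreover have "((h * d + cnj h * e) * a - b' * (h * b + cnj h * b')) / (a * a) =
      h * ((d * a - b * b') / a\<^sup>2) + cnj h * ((e * a - b' * b') / a\<^sup>2)" for h a b b' d e :: complex
    by (simp add: power2_eq_square algebra_simps flip: add_divide_distrib diff_divide_distrib)
  ultimately have "(wirtinger_dbar f has_derivative (\<lambda>h.
      h * ((cinner (\<gamma>' w) (\<gamma>' w) * cinner (\<gamma> w) (\<gamma> w) - cinner (\<gamma>' w) (\<gamma> w) * cinner (\<gamma> w) (\<gamma>' w)) / (cinner (\<gamma> w) (\<gamma> w))\<^sup>2)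
      + cnj h * ((cinner (\<gamma> w) (\<gamma>'' w) * cinner (\<gamma> w) (\<gamma> w) - cinner (\<gamma> w) (\<gamma>' w) * cinner (\<gamma> w) (\<gamma>' w)) / (cinner (\<gamma> w) (\<gamma> w))\<^sup>2)))
      (at w)"
    by simp
  from wirtinger_has_derivative(1)[OF this] show ?thesis unfolding f_def .
qed

section \<open>Change of frame and independence of the curvature\<close>

lemma has_derivative_scaleC:
  fixes \<gamma> :: "complex \<Rightarrow> 'a::complex_inner"
  assumes "(\<phi> has_field_derivative d) (at z)" "(\<gamma> has_derivative (\<lambda>h. h *\<^sub>C v)) (at z)"
  shows "((\<lambda>z. \<phi> z *\<^sub>C \<gamma> z) has_derivative (\<lambda>h. h *\<^sub>C (d *\<^sub>C \<gamma> z + \<phi> z *\<^sub>C v))) (at z)"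
  using bounded_bilinear.FDERIV[OF bounded_bilinear_scaleC
      assms(1)[unfolded has_field_derivative_def] assms(2)]
  by (simp add: scaleC_scaleC scaleC_add_right mult.commute add.commute)

text \<open>Another frame is \<open>\<phi> \<cdot> \<gamma>\<close> for a scalar holomorphic \<open>\<phi>\<close>, so it inherits the second
  derivatives, although \<^const>\<open>holomorphic_frame\<close> only provides first ones.\<close>
lemma holomorphic_frame_local_multiple:
  fixes \<gamma> :: "complex \<Rightarrow> 'a::complex_inner"
  assumes fr: "smooth_frame M S V \<gamma> \<gamma>' \<gamma>''" and w: "w \<in> V" "w \<in> U" and U: "open U"
    and hf: "holomorphic_frame M S U \<delta>"
    and dim: "\<And>z. z \<in> ball 0 1 \<Longrightarrow> cvec.dim (eigenspace M S z) = 1"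
  shows "\<exists>W \<delta>' \<delta>'' a b. w \<in> W \<and> smooth_frame M S W \<delta> \<delta>' \<delta>'' \<and>
    \<delta> w = a *\<^sub>C \<gamma> w \<and> \<delta>' w = b *\<^sub>C \<gamma> w + a *\<^sub>C \<gamma>' w"
proof -
  note fr' = smooth_frameD[OF fr]
  have cont: "continuous_on V (\<lambda>z. cinner (\<gamma> z) (\<gamma> w))"
    by (intro continuous_at_imp_continuous_on ballI
        has_derivative_continuous[OF bounded_linear.has_derivative[OF
          bounded_bilinear.bounded_linear_left[OF bounded_bilinear_cinner] fr'(6)]])
  \<comment> \<open>On W the pairing with the fixed vector \<gamma> w does not vanish, so the scalar
    factor \<phi> can be written as a quotient of inner products.\<close>
  define W where "W = {z \<in> V. cinner (\<gamma> z) (\<gamma> w) \<noteq> 0} \<inter> U"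
  have W: "open W" "w \<in> W" "W \<subseteq> V" "W \<subseteq> U"
  proof -
    have "W = (V \<inter> (\<lambda>z. cinner (\<gamma> z) (\<gamma> w)) -` (- {0})) \<inter> U" by (auto simp: W_def)
    moreover have "open (V \<inter> (\<lambda>z. cinner (\<gamma> z) (\<gamma> w)) -` (- {0}))"
      by (rule continuous_open_preimage[OF cont fr'(1)]) auto
    ultimately show "open W" using open_Int[OF _ U] by metis
    have "\<gamma> w \<noteq> 0" using fr'(5)[OF w(1)] .
    then show "w \<in> W" using w by (simp add: W_def)
  qed (auto simp: W_def)
  have mult: "\<exists>c. \<delta> z = c *\<^sub>C \<gamma> z" if z: "z \<in> W" for z
  proof -
    have zV: "z \<in> V" "z \<in> U" using z W by auto
    then have "\<delta> z \<in> eigenspace M S z" using hf by (simp add: holomorphic_frame_def)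
    obtain e where e: "\<And>x. x \<in> eigenspace M S z \<Longrightarrow> \<exists>c. x = c *\<^sub>C e"
      using dim_1_generator[OF dim[of z]] zV fr'(2) by blast
    obtain c d where c: "\<delta> z = c *\<^sub>C e" and d: "\<gamma> z = d *\<^sub>C e"
      using e[OF \<open>\<delta> z \<in> eigenspace M S z\<close>] e[OF fr'(8)[OF zV(1)]] by blast
    have "d \<noteq> 0" using d fr'(5)[OF zV(1)] by auto
    then have "\<delta> z = (c / d) *\<^sub>C \<gamma> z" by (simp add: c d scaleC_scaleC)
    then show ?thesis by blast
  qed
  define \<phi> where "\<phi> z = cinner (\<delta> z) (\<gamma> w) / cinner (\<gamma> z) (\<gamma> w)" for z
  have \<phi>: "\<delta> z = \<phi> z *\<^sub>C \<gamma> z" if z: "z \<in> W" for z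
  proof -
    obtain c where c: "\<delta> z = c *\<^sub>C \<gamma> z" using mult[OF z] by blast
    then show ?thesis using z by (simp add: \<phi>_def cinner_scaleC_left W_def)
  qed
  have ip: "((\<lambda>z. cinner (g z) (\<gamma> w)) has_field_derivative cinner v (\<gamma> w)) (at z)"
    if "(g has_derivative (\<lambda>h. h *\<^sub>C v)) (at z)" for g z v
    using bounded_linear.has_derivative[OF
        bounded_bilinear.bounded_linear_left[OF bounded_bilinear_cinner, of "\<gamma> w"] that]
    by (simp add: has_field_derivative_def cinner_scaleC_left mult_commute_abs)
  have \<delta>d: "\<exists>v. (\<delta> has_derivative (\<lambda>h. h *\<^sub>C v)) (at z)" if z: "z \<in> W" for z
  proof -
    have zU: "z \<in> U" using z W(4) by blast
    then show ?thesis
      using hf unfolding holomorphic_frame_def vector_holomorphic_on_def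
      by (simp add: at_within_open[OF _ U])
  qed
  have "\<phi> field_differentiable at z" if z: "z \<in> W" for z
  proof -
    obtain v where v: "(\<delta> has_derivative (\<lambda>h. h *\<^sub>C v)) (at z)" using \<delta>d[OF z] by blast
    have zV: "z \<in> V" and nz: "cinner (\<gamma> z) (\<gamma> w) \<noteq> 0" using z by (auto simp: W_def)
    show ?thesis
      unfolding \<phi>_def[abs_def] field_differentiable_def
      using DERIV_divide[OF ip[OF v] ip[OF fr'(6)[OF zV]] nz] by blast
  qed
  \<comment> \<open>One complex derivative on an open set makes the scalar \<phi> holomorphic; its
    second derivative is what supplies one for \<delta>.\<close>
  then have hol: "\<phi> holomorphic_on W"
    using W(1) by (simp add: holomorphic_on_open field_differentiable_def)
  have d1: "(\<phi> has_field_derivative deriv \<phi> z) (at z)" if "z \<in> W" for z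
    using holomorphic_derivI[OF hol W(1) that] .
  have d2: "(deriv \<phi> has_field_derivative deriv (deriv \<phi>) z) (at z)" if "z \<in> W" for z
    using holomorphic_derivI[OF holomorphic_deriv[OF hol W(1)] W(1) that] .
  define \<delta>' where "\<delta>' z = deriv \<phi> z *\<^sub>C \<gamma> z + \<phi> z *\<^sub>C \<gamma>' z" for z
  define \<delta>'' where "\<delta>'' z = (deriv (deriv \<phi>) z *\<^sub>C \<gamma> z + deriv \<phi> z *\<^sub>C \<gamma>' z) +
    (deriv \<phi> z *\<^sub>C \<gamma>' z + \<phi> z *\<^sub>C \<gamma>'' z)" for z
  have "smooth_frame M S W \<delta> \<delta>' \<delta>''"
    unfolding smooth_frame_def
  proof (intro conjI ballI)
    fix z assume z: "z \<in> W"
    then have zV: "z \<in> V" and zU: "z \<in> U" using W by auto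
    show "\<delta> z \<in> eigenspace M S z" "\<delta> z \<noteq> 0"
      using hf zU by (simp_all add: holomorphic_frame_def)
    have "((\<lambda>z. \<phi> z *\<^sub>C \<gamma> z) has_derivative (\<lambda>h. h *\<^sub>C \<delta>' z)) (at z)"
      unfolding \<delta>'_def by (rule has_derivative_scaleC[OF d1[OF z] fr'(6)[OF zV]])
    then show "(\<delta> has_derivative (\<lambda>h. h *\<^sub>C \<delta>' z)) (at z)"
      by (rule has_derivative_transform_within_open[OF _ W(1) z]) (simp add: \<phi>)
    have "((\<lambda>z. deriv \<phi> z *\<^sub>C \<gamma> z + \<phi> z *\<^sub>C \<gamma>' z) has_derivative
       (\<lambda>h. h *\<^sub>C (deriv (deriv \<phi>) z *\<^sub>C \<gamma> z + deriv \<phi> z *\<^sub>C \<gamma>' z) +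
            h *\<^sub>C (deriv \<phi> z *\<^sub>C \<gamma>' z + \<phi> z *\<^sub>C \<gamma>'' z))) (at z)"
      by (intro has_derivative_add has_derivative_scaleC d1 d2 z zV fr')
    then show "(\<delta>' has_derivative (\<lambda>h. h *\<^sub>C \<delta>'' z)) (at z)"
      unfolding \<delta>'_def[abs_def] \<delta>''_def by (simp add: scaleC_add_right)
  qed (use W fr'(2) in auto)
  then show ?thesis
    using W(2) \<phi>[OF W(2)] by (intro exI[of _ W] exI[of _ \<delta>'] exI[of _ \<delta>''] exI[of _ "\<phi> w"]
        exI[of _ "deriv \<phi> w"]) (simp add: \<delta>'_def)
qed

text \<open>The description by \<open>THE\<close> requires every admissible frame to give the same
  value. At w another frame has the data a \<gamma> and b \<gamma> + a \<gamma>'; the Gram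
  determinant ignores b, and |a|^4 cancels against the denominator.\<close>

lemma curvature_smooth_frame:
  fixes \<gamma> :: "complex \<Rightarrow> 'a::complex_inner"
  assumes fr: "smooth_frame M S V \<gamma> \<gamma>' \<gamma>''" and w: "w \<in> V"
    and dim: "\<And>z. z \<in> ball 0 1 \<Longrightarrow> cvec.dim (eigenspace M S z) = 1"
  shows "curvature M S w =
    - ((cinner (\<gamma>' w) (\<gamma>' w) * cinner (\<gamma> w) (\<gamma> w) - cinner (\<gamma>' w) (\<gamma> w) * cinner (\<gamma> w) (\<gamma>' w)) /
      (cinner (\<gamma> w) (\<gamma> w))\<^sup>2)" (is "_ = ?c")
  unfolding curvature_def
proof (rule the_equality)
  note fr' = smooth_frameD[OF fr]
  have "vector_holomorphic_on \<gamma> V"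
    unfolding vector_holomorphic_on_def using fr'(6) has_derivative_at_withinI by blast
  then have "holomorphic_frame M S V \<gamma>"
    using fr'(5,8) by (simp add: holomorphic_frame_def)
  then show "\<exists>U \<gamma>. open U \<and> w \<in> U \<and> U \<subseteq> ball 0 1 \<and> holomorphic_frame M S U \<gamma> \<and>
      ?c = - wirtinger_d (wirtinger_dbar (\<lambda>z. of_real (ln ((norm (\<gamma> z))\<^sup>2)))) w"
    using fr'(1,2) w wirtinger_ln_norm_smooth_frame[OF fr w]
    by (intro exI[of _ V] exI[of _ \<gamma>]) simp
next
  fix c
  assume "\<exists>U \<gamma>. open U \<and> w \<in> U \<and> U \<subseteq> ball 0 1 \<and> holomorphic_frame M S U \<gamma> \<and>
      c = - wirtinger_d (wirtinger_dbar (\<lambda>z. of_real (ln ((norm (\<gamma> z))\<^sup>2)))) w"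
  then obtain U \<delta> where U: "open U" "w \<in> U" "holomorphic_frame M S U \<delta>"
      "c = - wirtinger_d (wirtinger_dbar (\<lambda>z. of_real (ln ((norm (\<delta> z))\<^sup>2)))) w"
    by blast
  obtain W \<delta>' \<delta>'' a b where W: "w \<in> W" "smooth_frame M S W \<delta> \<delta>' \<delta>''"
      "\<delta> w = a *\<^sub>C \<gamma> w" "\<delta>' w = b *\<^sub>C \<gamma> w + a *\<^sub>C \<gamma>' w"
    using holomorphic_frame_local_multiple[OF fr w U(2,1,3) dim] by metis
  have a: "a \<noteq> 0" using smooth_frameD(5)[OF W(2,1)] W(3) by auto
  have "c = - ((cinner (\<delta>' w) (\<delta>' w) * cinner (\<delta> w) (\<delta> w) - cinner (\<delta>' w) (\<delta> w) * cinner (\<delta> w) (\<delta>' w)) /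
      (cinner (\<delta> w) (\<delta> w))\<^sup>2)"
    unfolding U(4) wirtinger_ln_norm_smooth_frame[OF W(2,1)] ..
  also have "cinner (\<delta>' w) (\<delta>' w) * cinner (\<delta> w) (\<delta> w) - cinner (\<delta>' w) (\<delta> w) * cinner (\<delta> w) (\<delta>' w) =
      (a * cnj a)\<^sup>2 * (cinner (\<gamma>' w) (\<gamma>' w) * cinner (\<gamma> w) (\<gamma> w) - cinner (\<gamma>' w) (\<gamma> w) * cinner (\<gamma> w) (\<gamma>' w))"
    unfolding W(3,4) cinner_simps by (simp add: power2_eq_square algebra_simps)
  also have "(cinner (\<delta> w) (\<delta> w))\<^sup>2 = (a * cnj a)\<^sup>2 * (cinner (\<gamma> w) (\<gamma> w))\<^sup>2"
    unfolding W(3) cinner_simps by (simp add: power2_eq_square algebra_simps)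
  finally show "c = ?c" using a by simp
qed

section \<open>Defect forms\<close>

text \<open>The form of the operator in \<open>hypercontraction\<close>, with the adjoints moved to
  the second slot. For k = n it is the form Q.\<close>

definition defect_form :: "('a::complex_inner \<Rightarrow> 'a) \<Rightarrow> nat \<Rightarrow> 'a \<Rightarrow> 'a \<Rightarrow> complex" where
  "defect_form T k x y = (\<Sum>j\<le>k. ((-1) ^ j * of_nat (k choose j)) * cinner ((T ^^ j) x) ((T ^^ j) y))"

lemma defect_form_0 [simp]: "defect_form T 0 x y = cinner x y"
  by (simp add: defect_form_def)

text \<open>Pascal's rule. This recursion in the order drives most of the inductions on defect
  forms.\<close>

lemma defect_form_Suc:
  "defect_form T (Suc k) x y = defect_form T k x y - defect_form T k (T x) (T y)"
proof -
  define f where "f j = cinner ((T ^^ j) x) ((T ^^ j) y)" for j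
  have 1: "defect_form T k x y = f 0 + (\<Sum>j\<le>k. (-1) ^ Suc j * of_nat (k choose Suc j) * f (Suc j))"
  proof -
    \<comment> \<open>The added last term is zero because k choose k + 1 vanishes; it lets the sum
      be shifted uniformly.\<close>
    have "defect_form T k x y = (\<Sum>j\<le>Suc k. (-1) ^ j * of_nat (k choose j) * f j)"
      by (simp add: defect_form_def f_def)
    then show ?thesis
      by (simp only: sum.atMost_Suc_shift) simp
  qed
  have 2: "defect_form T k (T x) (T y) = (\<Sum>j\<le>k. (-1) ^ j * of_nat (k choose j) * f (Suc j))"
    by (simp add: defect_form_def f_def funpow_swap1)
  have "defect_form T (Suc k) x y = (\<Sum>j\<le>Suc k. (-1) ^ j * of_nat (Suc k choose j) * f j)"
    by (simp add: defect_form_def f_def)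
  also have "\<dots> = f 0 + (\<Sum>j\<le>k. (-1) ^ Suc j * of_nat (Suc k choose Suc j) * f (Suc j))"
    by (simp only: sum.atMost_Suc_shift) simp
  also have "(\<Sum>j\<le>k. (-1) ^ Suc j * of_nat (Suc k choose Suc j) * f (Suc j)) =
      (\<Sum>j\<le>k. (-1) ^ Suc j * of_nat (k choose Suc j) * f (Suc j)) -
      (\<Sum>j\<le>k. (-1) ^ j * of_nat (k choose j) * f (Suc j))"
    unfolding sum_subtractf[symmetric]
    by (rule sum.cong[OF refl]) (simp add: algebra_simps)
  finally show ?thesis using 1 2 by simp
qed

lemma defect_form_sesquilinear:
  fixes T :: "'a::complex_inner \<Rightarrow> 'a"
  assumes T: "bounded_linear T" and TC: "\<And>a x. T (a *\<^sub>C x) = a *\<^sub>C T x"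
  shows "defect_form T k (x + y) z = defect_form T k x z + defect_form T k y z"
    and "defect_form T k (a *\<^sub>C x) z = a * defect_form T k x z"
    and "defect_form T k z (x + y) = defect_form T k z x + defect_form T k z y"
    and "defect_form T k z (a *\<^sub>C x) = cnj a * defect_form T k z x"
    and "defect_form T k y x = cnj (defect_form T k x y)"
proof -
  interpret T: bounded_linear T by fact
  show "defect_form T k (x + y) z = defect_form T k x z + defect_form T k y z"
    by (induction k arbitrary: x y z) (simp_all add: cinner_simps defect_form_Suc T.add)
  show "defect_form T k (a *\<^sub>C x) z = a * defect_form T k x z"
    by (induction k arbitrary: x z) (simp_all add: cinner_simps defect_form_Suc TC algebra_simps)
  show "defect_form T k z (x + y) = defect_form T k z x + defect_form T k z y"
    by (induction k arbitrary: x y z) (simp_all add: cinner_simps defect_form_Suc T.add)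
  show "defect_form T k z (a *\<^sub>C x) = cnj a * defect_form T k z x"
    by (induction k arbitrary: x z) (simp_all add: cinner_simps defect_form_Suc TC algebra_simps)
  show "defect_form T k y x = cnj (defect_form T k x y)"
  proof (induction k arbitrary: x y)
    case 0
    show ?case unfolding defect_form_0 by (rule cinner_commute)
  next
    case (Suc k)
    show ?case
      unfolding defect_form_Suc complex_cnj_diff
      using Suc[of y x] Suc[of "T y" "T x"] by metis
  qed
qed

lemma bounded_linear_defect_form:
  fixes T :: "'a::complex_inner \<Rightarrow> 'a"
  assumes T: "bounded_linear T"
  shows "bounded_linear (\<lambda>u. defect_form T k u x)"
proof (induction k arbitrary: x)
  case 0
  then show ?case
    using bounded_bilinear.bounded_linear_left[OF bounded_bilinear_cinner] by simp
next
  case (Suc k)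
  show ?case
    unfolding defect_form_Suc
    by (intro bounded_linear_sub Suc.IH bounded_linear_compose[OF Suc.IH T])
qed

text \<open>The correction term of the recursion contains T e = 0. This provides the base point, w =
  0, for comparing eigenvectors.\<close>

lemma defect_form_kernel:
  assumes T: "bounded_linear T" and "T e = 0"
  shows "defect_form T k e x = cinner e x"
proof (induction k arbitrary: x)
  case (Suc k)
  have "defect_form T k 0 y = 0" for y
    using bounded_linear_defect_form[OF T] by (rule linear_simps(3))
  then show ?case using Suc by (simp add: defect_form_Suc assms(2))
qed simp

section \<open>Positivity of the defect forms\<close>

lemma cinner_cadjoint_funpow:
  fixes T :: "'a::chilbert_space \<Rightarrow> 'a"
  assumes T: "bounded_linear T" and TC: "\<And>a x. T (a *\<^sub>C x) = a *\<^sub>C T x"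
  shows "cinner ((cadjoint T ^^ j) u) x = cinner u ((T ^^ j) x)"
proof (induction j arbitrary: x)
  case (Suc j)
  have "cinner (cadjoint T v) x = cinner v (T x)" for v
    using cadjoint[OF T TC, of x v] by (metis cinner_commute)
  then show ?case using Suc[of "T x"] by (simp add: funpow_swap1[of T])
qed simp

lemma psd_form_defect_form:
  fixes T :: "'a::chilbert_space \<Rightarrow> 'a"
  assumes T: "bounded_linear T" and TC: "\<And>a x. T (a *\<^sub>C x) = a *\<^sub>C T x"
    and h: "hypercontraction n T" and k: "1 \<le> k" "k \<le> n"
  shows "psd_form (defect_form T k)"
  unfolding psd_form_def
proof (intro conjI allI)
  fix x
  have "cinner (\<Sum>j=0..k. ((-1) ^ j * of_nat (k choose j)) *\<^sub>C (cadjoint T ^^ j) ((T ^^ j) x)) x \<in> \<real>\<^sub>\<ge>\<^sub>0"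
    using h k by (auto simp: hypercontraction_def positive_operator_def)
  also have "cinner (\<Sum>j=0..k. ((-1) ^ j * of_nat (k choose j)) *\<^sub>C (cadjoint T ^^ j) ((T ^^ j) x)) x
      = defect_form T k x x"
    by (simp add: cinner_sum_left cinner_scaleC_left cinner_cadjoint_funpow[OF T TC]
        defect_form_def atLeast0AtMost)
  finally show "0 \<le> Re (defect_form T k x x)"
    by (simp add: complex_nonneg_Reals_iff)
  show "defect_form T k y x = cnj (defect_form T k x y)" for y
    by (rule defect_form_sesquilinear(5)[OF T TC])
qed (simp_all add: defect_form_sesquilinear(1-4)[OF T TC])

text \<open>Positivity of order one is the difference of the squared norms of x and T x.\<close>

lemma hypercontraction_imp_contraction:
  fixes T :: "'a::chilbert_space \<Rightarrow> 'a"
  assumes T: "bounded_linear T" and TC: "\<And>a x. T (a *\<^sub>C x) = a *\<^sub>C T x"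
    and h: "hypercontraction n T" and n: "1 \<le> n"
  shows "norm (T x) \<le> norm x"
proof -
  have "0 \<le> Re (defect_form T 1 x x)"
    using psd_formD(4)[OF psd_form_defect_form[OF T TC h]] n by blast
  then have "(norm (T x))\<^sup>2 \<le> (norm x)\<^sup>2"
    by (simp add: defect_form_Suc Re_cinner_self)
  then show ?thesis
    by (rule power2_le_imp_le) simp
qed

section \<open>Defect forms and Gram determinants on eigenvectors\<close>

lemma defect_form_eigenvector:
  fixes T :: "'a::complex_inner \<Rightarrow> 'a"
  assumes T: "bounded_linear T" and TC: "\<And>a x. T (a *\<^sub>C x) = a *\<^sub>C T x"
    and u: "T u = z *\<^sub>C u"
  shows "defect_form T k u u = (1 - z * cnj z) ^ k * cinner u u"
proof (induction k)
  case (Suc k)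
  have "defect_form T (Suc k) u u = (1 - z * cnj z) * defect_form T k u u"
    by (simp add: defect_form_Suc u defect_form_sesquilinear(2,4)[OF T TC] left_diff_distrib)
  then show ?case by (simp add: Suc)
qed simp

lemma one_minus_norm_square_nonzero:
  assumes "cmod w < 1" shows "1 - w * cnj w \<noteq> 0"
proof -
  have "(cmod w)\<^sup>2 \<noteq> 1"
    using assms by (metis abs_norm_cancel abs_square_less_1 less_irrefl)
  then show ?thesis
    unfolding complex_norm_square[symmetric] by (metis eq_iff_diff_eq_0 of_real_eq_1_iff)
qed

text \<open>With \<open>A\<^sub>k\<close> the value of the form at \<open>(u, u)\<close>, the Gram determinants satisfy
  \<open>det\<^sub>k\<^sub>+\<^sub>1 = (1 - |z|\<^sup>2)\<^sup>2 det\<^sub>k - A\<^sub>k\<^sup>2\<close>. The factor \<open>(1 - |z|\<^sup>2)\<^sup>2\<close> in the statement avoids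
  negative powers.\<close>
lemma defect_form_gram_det:
  fixes T :: "'a::complex_inner \<Rightarrow> 'a"
  assumes T: "bounded_linear T" and TC: "\<And>a x. T (a *\<^sub>C x) = a *\<^sub>C T x"
    and u: "T u = z *\<^sub>C u" and v: "T v = z *\<^sub>C v + u"
  defines "s \<equiv> z * cnj z"
  shows "(1 - s)\<^sup>2 * (defect_form T k v v * defect_form T k u u - defect_form T k v u * defect_form T k u v) =
    (1 - s) ^ (2 * k) * ((1 - s)\<^sup>2 * (cinner v v * cinner u u - cinner v u * cinner u v) -
      of_nat k * (cinner u u)\<^sup>2)"
proof (induction k)
  case (Suc k)
  note ses = defect_form_sesquilinear[OF T TC]
  define A B B' D where "A = defect_form T k u u" and "B = defect_form T k v u"
    and "B' = defect_form T k u v" and "D = defect_form T k v v"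
  have A: "A = (1 - s) ^ k * cinner u u"
    unfolding A_def s_def by (rule defect_form_eigenvector[OF T TC u])
  have rec: "defect_form T (Suc k) u u = (1 - s) * A"
    "defect_form T (Suc k) v u = (1 - s) * B - cnj z * A"
    "defect_form T (Suc k) u v = (1 - s) * B' - z * A"
    "defect_form T (Suc k) v v = (1 - s) * D - z * B - cnj z * B' - A"
    by (simp_all add: defect_form_Suc u v ses(1-4) A_def B_def B'_def D_def s_def algebra_simps)
  \<comment> \<open>The terms linear in B and B' cancel, and the remaining multiples of A^2 add up
    to -(1 - s) - s = -1.\<close>
  have "defect_form T (Suc k) v v * defect_form T (Suc k) u u -
      defect_form T (Suc k) v u * defect_form T (Suc k) u v = (1 - s)\<^sup>2 * (D * A - B * B') - A\<^sup>2"
    unfolding rec s_def by (simp add: power2_eq_square algebra_simps)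
  then have "(1 - s)\<^sup>2 * (defect_form T (Suc k) v v * defect_form T (Suc k) u u -
      defect_form T (Suc k) v u * defect_form T (Suc k) u v) =
      (1 - s)\<^sup>2 * ((1 - s)\<^sup>2 * (D * A - B * B')) - (1 - s)\<^sup>2 * A\<^sup>2"
    by (simp add: right_diff_distrib)
  also have "\<dots> = (1 - s) ^ (2 * Suc k) * ((1 - s)\<^sup>2 * (cinner v v * cinner u u - cinner v u * cinner u v) -
      of_nat (Suc k) * (cinner u u)\<^sup>2)"
    unfolding Suc[folded A_def B_def B'_def D_def] unfolding A
    by (simp add: power_mult_distrib power_add power_mult algebra_simps power2_eq_square)
  finally show ?case .
qed simp

text \<open>Equality in Cauchy-Schwarz: v minus its q-projection on u is a null vector, hence in the
  radical.\<close>

lemma psd_form_parallel: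
  assumes q: "psd_form q" and nz: "q u u \<noteq> 0" and det: "q v v * q u u = q v u * q u v"
  shows "q v x = q v u / q u u * q u x"
proof -
  define a where "a = q v u / q u u"
  have au: "a * q u u = q v u" using nz by (simp add: a_def)
  have "q (v - a *\<^sub>C u) v = 0"
    using nz det by (simp add: psd_form_diff_left[OF q] psd_formD(2)[OF q] a_def field_simps)
  moreover have "q (v - a *\<^sub>C u) u = 0"
    by (simp add: psd_form_diff_left[OF q] psd_formD(2)[OF q] au)
  ultimately have "q (v - a *\<^sub>C u) (v - a *\<^sub>C u) = 0"
    using psd_form_add_right[OF q, of "v - a *\<^sub>C u" "v - a *\<^sub>C u" "a *\<^sub>C u"]
    by (simp add: psd_form_scaleC_right[OF q])
  from psd_form_kernel[OF q this, of x] show ?thesis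
    by (simp add: psd_form_diff_left[OF q] psd_formD(2)[OF q] a_def)
qed

section \<open>Rigidity of the defect form on eigenvectors\<close>

text \<open>Differentiate the eigenvalue equation T (\<gamma> z) = z \<gamma> z in both
  ways.\<close>

lemma smooth_frame_generalized_eigenvector:
  fixes T :: "'a::complex_inner \<Rightarrow> 'a"
  assumes T: "bounded_linear T" and TC: "\<And>a x. T (a *\<^sub>C x) = a *\<^sub>C T x"
    and fr: "smooth_frame M T V \<gamma> \<gamma>' \<gamma>''" and z: "z \<in> V"
  shows "T (\<gamma>' z) = z *\<^sub>C \<gamma>' z + \<gamma> z"
proof -
  note fr' = smooth_frameD[OF fr]
  have "((\<lambda>z. z *\<^sub>C \<gamma> z) has_derivative (\<lambda>h. h *\<^sub>C (1 *\<^sub>C \<gamma> z + z *\<^sub>C \<gamma>' z))) (at z)"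
    by (rule has_derivative_scaleC[OF DERIV_ident fr'(6)[OF z]])
  then have "((\<lambda>z. T (\<gamma> z)) has_derivative (\<lambda>h. h *\<^sub>C (1 *\<^sub>C \<gamma> z + z *\<^sub>C \<gamma>' z))) (at z)"
    by (rule has_derivative_transform_within_open[OF _ fr'(1) z]) (simp add: fr'(4))
  moreover have "((\<lambda>z. T (\<gamma> z)) has_derivative (\<lambda>h. T (h *\<^sub>C \<gamma>' z))) (at z)"
    by (rule bounded_linear.has_derivative[OF T fr'(6)[OF z]])
  ultimately have "(\<lambda>h. h *\<^sub>C (1 *\<^sub>C \<gamma> z + z *\<^sub>C \<gamma>' z)) = (\<lambda>h. T (h *\<^sub>C \<gamma>' z))"
    by (rule has_derivative_unique)
  from fun_cong[OF this, of 1] show ?thesis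
    by (simp add: scaleC_one add.commute)
qed

text \<open>With denominators cleared, the curvature equation kills the bracket in
  \<open>defect_form_gram_det\<close> at k = n, so \<open>psd_form_parallel\<close> applies. The
  number a is a logarithmic derivative of z \<mapsto> Q(\<gamma> z, x) common to all x.\<close>

lemma defect_form_frame_log_derivative:
  fixes T :: "'a::chilbert_space \<Rightarrow> 'a"
  assumes T: "bounded_linear T" and TC: "\<And>a x. T (a *\<^sub>C x) = a *\<^sub>C T x"
    and psd: "psd_form (defect_form T n)"
    and dim: "\<And>z. z \<in> ball 0 1 \<Longrightarrow> cvec.dim (eigenspace M T z) = 1"
    and curv: "\<And>z. z \<in> ball 0 1 \<Longrightarrow> curvature M T z = - of_nat n / of_real ((1 - (cmod z)\<^sup>2)\<^sup>2)"
    and fr: "smooth_frame M T V \<gamma> \<gamma>' \<gamma>''" and z: "z \<in> V"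
  shows "\<exists>a. \<forall>x. defect_form T n (\<gamma>' z) x = a * defect_form T n (\<gamma> z) x"
proof -
  note fr' = smooth_frameD[OF fr]
  define s where "s = z * cnj z"
  have zb: "z \<in> ball 0 1" using z fr'(2) by blast
  have s: "of_real ((1 - (cmod z)\<^sup>2)\<^sup>2) = (1 - s)\<^sup>2"
    unfolding s_def complex_norm_square[symmetric] by (simp only: of_real_power of_real_diff of_real_1)
  have s1: "1 - s \<noteq> 0"
    unfolding s_def using zb by (intro one_minus_norm_square_nonzero) simp
  define A0 where "A0 = cinner (\<gamma> z) (\<gamma> z)"
  define det where "det = cinner (\<gamma>' z) (\<gamma>' z) * cinner (\<gamma> z) (\<gamma> z) - cinner (\<gamma>' z) (\<gamma> z) * cinner (\<gamma> z) (\<gamma>' z)"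
  have A0: "A0 \<noteq> 0" using fr'(5)[OF z] by (simp add: A0_def)
  have "det / A0\<^sup>2 = of_nat n / (1 - s)\<^sup>2"
    using curvature_smooth_frame[OF fr z dim] curv[OF zb] unfolding det_def A0_def s by simp
  then have det: "(1 - s)\<^sup>2 * det - of_nat n * A0\<^sup>2 = 0"
    using A0 s1 by (simp add: field_simps)
  have u: "T (\<gamma> z) = z *\<^sub>C \<gamma> z" by (rule fr'(4)[OF z])
  have "(1 - s)\<^sup>2 * (defect_form T n (\<gamma>' z) (\<gamma>' z) * defect_form T n (\<gamma> z) (\<gamma> z) -
      defect_form T n (\<gamma>' z) (\<gamma> z) * defect_form T n (\<gamma> z) (\<gamma>' z)) = 0"
    using defect_form_gram_det[OF T TC u smooth_frame_generalized_eigenvector[OF T TC fr z], of n,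
        folded s_def det_def A0_def] det by simp
  then have "defect_form T n (\<gamma>' z) (\<gamma>' z) * defect_form T n (\<gamma> z) (\<gamma> z) =
      defect_form T n (\<gamma>' z) (\<gamma> z) * defect_form T n (\<gamma> z) (\<gamma>' z)"
    using s1 by simp
  moreover have "defect_form T n (\<gamma> z) (\<gamma> z) \<noteq> 0"
    unfolding defect_form_eigenvector[OF T TC u] using s1 A0 by (simp add: s_def A0_def)
  ultimately show ?thesis
    using psd_form_parallel[OF psd] by blast
qed

text \<open>The holomorphic functions Q(\<gamma> z, x) share the equation g' = a g, so their
  quotients are constant. The reference x = \<gamma> w is safe as a denominator because Q(\<gamma>
  w, \<gamma> w) = (1 - |w|^2)^n <\<gamma> w, \<gamma> w> is nonzero.\<close>

lemma defect_form_frame_locally_proportional: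
  fixes T :: "'a::chilbert_space \<Rightarrow> 'a"
  assumes T: "bounded_linear T" and TC: "\<And>a x. T (a *\<^sub>C x) = a *\<^sub>C T x"
    and fr: "smooth_frame M T (ball w r) \<gamma> \<gamma>' \<gamma>''" and r: "r > 0"
    and log: "\<And>z. z \<in> ball w r \<Longrightarrow>
        \<exists>a. \<forall>x. defect_form T n (\<gamma>' z) x = a * defect_form T n (\<gamma> z) x"
  shows "\<exists>s>0. s \<le> r \<and> (\<forall>z\<in>ball w s. \<exists>c\<noteq>0. \<forall>x. defect_form T n (\<gamma> z) x = c * defect_form T n (\<gamma> w) x)"
proof -
  note fr' = smooth_frameD[OF fr]
  define g where "g x z = defect_form T n (\<gamma> z) x" for x z
  have g: "(g x has_field_derivative defect_form T n (\<gamma>' z) x) (at z)" if "z \<in> ball w r" for x z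
    using bounded_linear.has_derivative[OF bounded_linear_defect_form[OF T] fr'(6)[OF that], of n x]
    by (simp add: g_def[abs_def] has_field_derivative_def defect_form_sesquilinear(1-4)[OF T TC]
        mult_commute_abs)
  have wr: "w \<in> ball w r" using r by simp
  have w1: "w \<in> ball 0 1" using fr'(2) wr by blast
  have nz: "g (\<gamma> w) w \<noteq> 0"
  proof -
    have "1 - w * cnj w \<noteq> 0"
      using w1 by (intro one_minus_norm_square_nonzero) simp
    then show ?thesis
      unfolding g_def defect_form_eigenvector[OF T TC fr'(4)[OF wr]] using fr'(5)[OF wr] by simp
  qed
  obtain s0 where s0: "s0 > 0" "\<And>z. dist w z < s0 \<Longrightarrow> g (\<gamma> w) z \<noteq> 0"
    using continuous_at_avoid[OF DERIV_isCont[OF g[OF wr]] nz] by blast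
  \<comment> \<open>Shrinks the ball until the denominator has no zero.\<close>
  define s where "s = min s0 r"
  have "\<exists>c\<noteq>0. \<forall>x. g x z = c * g x w" if z: "z \<in> ball w s" for z
  proof (intro exI[of _ "g (\<gamma> w) z / g (\<gamma> w) w"] conjI allI)
    show "g (\<gamma> w) z / g (\<gamma> w) w \<noteq> 0" using z s0 nz by (simp add: s_def)
    fix x
    have "\<exists>c. \<forall>y\<in>ball w s. g x y / g (\<gamma> w) y = c"
    proof (rule has_field_derivative_zero_constant)
      fix y assume "y \<in> ball w s"
      then have y: "y \<in> ball w r" and ny: "g (\<gamma> w) y \<noteq> 0" using s0 by (auto simp: s_def)
      obtain a where a: "\<And>x. defect_form T n (\<gamma>' y) x = a * g x y"
        using log[OF y] unfolding g_def by blast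
      have "((\<lambda>y. g x y / g (\<gamma> w) y) has_field_derivative 0) (at y)"
        using DERIV_divide[OF g[OF y] g[OF y] ny, of x] by (simp add: a mult_ac)
      then show "((\<lambda>y. g x y / g (\<gamma> w) y) has_field_derivative 0) (at y within ball w s)"
        by (rule has_field_derivative_at_within)
    qed simp
    then have "g x z / g (\<gamma> w) z = g x w / g (\<gamma> w) w"
      using z r s0(1) by (metis centre_in_ball min_less_iff_conj s_def)
    then show "g x z = g (\<gamma> w) z / g (\<gamma> w) w * g x w"
      using nz s0(2)[of z] z by (simp add: s_def field_simps)
  qed
  then show ?thesis
    using s0(1) r unfolding g_def by (intro exI[of _ s]) (auto simp: s_def)
qed

text \<open>Local proportionality makes the property P locally constant on the disc, and
  connectedness carries it from 0, where the eigenspace is spanned by e, to w.\<close>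

lemma defect_form_eigenvectors_proportional:
  fixes T :: "'a::chilbert_space \<Rightarrow> 'a"
  assumes T: "bounded_linear T" and TC: "\<And>a x. T (a *\<^sub>C x) = a *\<^sub>C T x"
    and psd: "psd_form (defect_form T n)" and B1: "cowen_douglas_B1 M T"
    and curv: "\<And>z. z \<in> ball 0 1 \<Longrightarrow> curvature M T z = - of_nat n / of_real ((1 - (cmod z)\<^sup>2)\<^sup>2)"
    and e: "\<And>u. u \<in> eigenspace M T 0 \<Longrightarrow> \<exists>c. u = c *\<^sub>C e" and Te: "T e = 0"
    and w: "w \<in> ball 0 1" and u: "u \<in> eigenspace M T w"
  shows "\<exists>c. \<forall>x. defect_form T n u x = c * cinner e x"
proof -
  have dim: "cvec.dim (eigenspace M T z) = 1" if "z \<in> ball 0 1" for z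
    using B1 that by (simp add: cowen_douglas_B1_def)
  define P where "P z \<longleftrightarrow> (\<forall>u\<in>eigenspace M T z. \<exists>c. \<forall>x. defect_form T n u x = c * cinner e x)" for z
  have "P w"
  proof (rule connected_induction_simple[of "ball 0 1" 0 w])
    show "P 0"
      unfolding P_def
    proof
      fix u assume "u \<in> eigenspace M T 0"
      then obtain c where "u = c *\<^sub>C e" using e by blast
      then show "\<exists>c. \<forall>x. defect_form T n u x = c * cinner e x"
        by (auto simp: defect_form_sesquilinear(1-4)[OF T TC] defect_form_kernel[OF T Te])
    qed
    fix a :: complex assume a: "a \<in> ball 0 1"
    obtain r \<gamma> \<gamma>' \<gamma>'' where r: "r > 0" and fr: "smooth_frame M T (ball a r) \<gamma> \<gamma>' \<gamma>''"
      using smooth_frame_exists[OF T TC B1 a] by blast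
    note fr' = smooth_frameD[OF fr]
    obtain s where s: "s > 0" "s \<le> r"
      "\<And>z. z \<in> ball a s \<Longrightarrow> \<exists>c\<noteq>0. \<forall>x. defect_form T n (\<gamma> z) x = c * defect_form T n (\<gamma> a) x"
      using defect_form_frame_locally_proportional[OF T TC fr r
        defect_form_frame_log_derivative[OF T TC psd dim curv fr]] by blast
    \<comment> \<open>The right side does not mention z. The direction from z back to a divides by
      the factor c, which is why local proportionality was stated with c nonzero.\<close>
    have P_iff: "P z \<longleftrightarrow> (\<exists>c. \<forall>x. defect_form T n (\<gamma> a) x = c * cinner e x)" if z: "z \<in> ball a s" for z
    proof -
      have zr: "z \<in> ball a r" using z s(2) by simp
      then have z1: "z \<in> ball 0 1" using fr'(2) by blast
      obtain c where c: "c \<noteq> 0" "\<And>x. defect_form T n (\<gamma> z) x = c * defect_form T n (\<gamma> a) x"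
        using s(3)[OF z] by blast
      obtain b where b: "\<And>x. x \<in> eigenspace M T z \<Longrightarrow> \<exists>c. x = c *\<^sub>C b"
        using dim_1_generator[OF dim[OF z1]] by blast
      show ?thesis
      proof
        assume "P z"
        then obtain d where "\<And>x. defect_form T n (\<gamma> z) x = d * cinner e x"
          using fr'(8)[OF zr] unfolding P_def by blast
        then have "\<forall>x. defect_form T n (\<gamma> a) x = (d / c) * cinner e x"
          using c by (simp add: field_simps)
        then show "\<exists>c. \<forall>x. defect_form T n (\<gamma> a) x = c * cinner e x" by blast
      next
        assume "\<exists>c. \<forall>x. defect_form T n (\<gamma> a) x = c * cinner e x"
        then obtain d where d: "\<And>x. defect_form T n (\<gamma> a) x = d * cinner e x" by blast
        show "P z"
          unfolding P_def
        proof
          fix u assume "u \<in> eigenspace M T z"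
          then obtain p where p: "u = p *\<^sub>C b" using b by blast
          obtain q where q: "\<gamma> z = q *\<^sub>C b" using b[OF fr'(8)[OF zr]] by blast
          have "q \<noteq> 0" using q fr'(5)[OF zr] by auto
          then have "u = (p / q) *\<^sub>C \<gamma> z" by (simp add: p q scaleC_scaleC)
          then have "\<forall>x. defect_form T n u x = (p / q * (c * d)) * cinner e x"
            by (simp add: defect_form_sesquilinear(1-4)[OF T TC] c(2) d)
          then show "\<exists>c. \<forall>x. defect_form T n u x = c * cinner e x" by blast
        qed
      qed
    qed
    have "ball a s \<subseteq> ball 0 1"
      using subset_ball[OF s(2)] fr'(2) by (rule order_trans)
    then show "\<exists>S. openin (top_of_set (ball 0 1)) S \<and> a \<in> S \<and> (\<forall>x\<in>S. \<forall>y\<in>S. P x \<longrightarrow> P y)"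
      using s(1) P_iff by (intro exI[of _ "ball a s"]) (auto intro: open_subset)
  qed (use w in auto)
  then show ?thesis using u unfolding P_def by blast
qed

section \<open>Power series expansion along the orbit\<close>

text \<open>The Taylor coefficients of \<open>(1 - t)\<^sup>-\<^sup>m\<close>.\<close>
fun geom_coeff :: "nat \<Rightarrow> nat \<Rightarrow> real" where
  "geom_coeff 0 i = (if i = 0 then 1 else 0)"
| "geom_coeff (Suc m) i = (\<Sum>l\<le>i. geom_coeff m l)"

lemma geom_coeff_nonneg: "0 \<le> geom_coeff m i"
  by (induction m arbitrary: i) (auto intro: sum_nonneg)

lemma geom_coeff_at_0: "geom_coeff m 0 = 1"
  by (induction m) auto

text \<open>The term l = 0 of the sum is already 1. Positivity lets these coefficients be divided
  out of a vanishing power series later.\<close>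

lemma geom_coeff_pos: "1 \<le> m \<Longrightarrow> 0 < geom_coeff m i"
proof (cases m)
  case (Suc k)
  have "geom_coeff k 0 \<le> (\<Sum>l\<le>i. geom_coeff k l)"
    by (rule member_le_sum) (auto simp: geom_coeff_nonneg)
  then show ?thesis by (simp add: Suc geom_coeff_at_0)
qed simp

text \<open>Raising m by one is a Cauchy product with the geometric series.\<close>

lemma geom_coeff_summable:
  assumes r: "0 \<le> r" "r < 1"
  shows "summable (\<lambda>i. geom_coeff m i * r ^ i)"
proof (induction m)
  case 0
  have "(\<lambda>i. geom_coeff 0 i * r ^ i) sums (\<Sum>i\<in>{0}. geom_coeff 0 i * r ^ i)"
    by (rule sums_finite) auto
  then show ?case by (rule sums_summable)
next
  case (Suc m)
  have g: "summable (\<lambda>i. norm (r ^ i))" using r by (simp add: summable_geometric)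
  have s: "summable (\<lambda>i. norm (geom_coeff m i * r ^ i))"
    using Suc r by (simp add: geom_coeff_nonneg)
  have "summable (\<lambda>k. \<Sum>i\<le>k. (geom_coeff m i * r ^ i) * r ^ (k - i))"
    by (rule summable_Cauchy_product[OF s g])
  moreover have "(\<Sum>i\<le>k. (geom_coeff m i * r ^ i) * r ^ (k - i)) = geom_coeff (Suc m) k * r ^ k" for k
    by (auto simp: sum_distrib_right mult.assoc power_add[symmetric] intro!: sum.cong)
  ultimately show ?case by simp
qed

lemma orbit_series_bounded:
  fixes T :: "'a::real_normed_vector \<Rightarrow> 'a" and a :: "'a \<Rightarrow> complex"
  assumes T: "\<And>x. norm (T x) \<le> norm x" and w: "cmod w < 1"
    and a: "\<And>x. cmod (a x) \<le> K * norm x"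
  shows "summable (\<lambda>i. of_real (geom_coeff m i) * w ^ i * a ((T ^^ i) x))"
    and "cmod (\<Sum>i. of_real (geom_coeff m i) * w ^ i * a ((T ^^ i) x)) \<le>
      (\<Sum>i. geom_coeff m i * cmod w ^ i) * K * norm x"
proof -
  have orb: "norm ((T ^^ i) x) \<le> norm x" for i
    by (induction i) (auto intro: order_trans[OF T])
  have a': "cmod (a ((T ^^ i) x)) \<le> K * norm x" for i
  \<comment> \<open>The sign of K is not assumed; the bound on a forces K to be nonnegative as soon
    as some x has nonzero norm.\<close>
  proof (cases "norm x = 0")
    case True
    then show ?thesis using orb[of i] a[of "(T ^^ i) x"] by simp
  next
    case False
    have "0 \<le> K * norm x" using order_trans[OF norm_ge_zero a] .
    then have "0 \<le> K" using False by (simp add: zero_le_mult_iff)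
    then show ?thesis using order_trans[OF a mult_left_mono[OF orb]] by blast
  qed
  have b: "norm (of_real (geom_coeff m i) * w ^ i * a ((T ^^ i) x)) \<le>
      geom_coeff m i * cmod w ^ i * (K * norm x)" for i
    using mult_left_mono[OF a'[of i], of "geom_coeff m i * cmod w ^ i"]
    by (simp add: norm_mult norm_power geom_coeff_nonneg)
  have sm: "summable (\<lambda>i. geom_coeff m i * cmod w ^ i * (K * norm x))"
    using geom_coeff_summable[of "cmod w" m] w by (intro summable_mult2) auto
  have smn: "summable (\<lambda>i. norm (of_real (geom_coeff m i) * w ^ i * a ((T ^^ i) x)))"
    by (rule summable_comparison_test'[OF sm]) (use b in simp)
  then show "summable (\<lambda>i. of_real (geom_coeff m i) * w ^ i * a ((T ^^ i) x))"
    by (rule summable_norm_cancel)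
  have "cmod (\<Sum>i. of_real (geom_coeff m i) * w ^ i * a ((T ^^ i) x)) \<le>
      (\<Sum>i. geom_coeff m i * cmod w ^ i * (K * norm x))"
    using order_trans[OF summable_norm[OF smn] suminf_le[OF b smn sm]] .
  also have "\<dots> = (\<Sum>i. geom_coeff m i * cmod w ^ i) * (K * norm x)"
    using geom_coeff_summable[of "cmod w" m] w by (intro suminf_mult2[symmetric]) auto
  finally show "cmod (\<Sum>i. of_real (geom_coeff m i) * w ^ i * a ((T ^^ i) x)) \<le>
      (\<Sum>i. geom_coeff m i * cmod w ^ i) * K * norm x" by (simp add: mult.assoc)
qed

text \<open>Solves \<open>f - w (f \<circ> T) = g\<close> for a bounded \<open>f\<close>; uniqueness of the solution comes from \<open>|w| < 1\<close>.\<close>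
lemma orbit_series_step:
  fixes T :: "'a::real_normed_vector \<Rightarrow> 'a" and a f :: "'a \<Rightarrow> complex"
  assumes T: "\<And>x. norm (T x) \<le> norm x" and w: "cmod w < 1"
    and a: "\<And>x. cmod (a x) \<le> K * norm x" and f: "\<And>x. cmod (f x) \<le> L * norm x"
    and eq: "\<And>x. (\<lambda>i. of_real (geom_coeff m i) * w ^ i * a ((T ^^ i) x)) sums (f x - w * f (T x))"
  shows "(\<lambda>i. of_real (geom_coeff (Suc m) i) * w ^ i * a ((T ^^ i) x)) sums f x"
proof -
  define F where "F x = (\<Sum>i. of_real (geom_coeff (Suc m) i) * w ^ i * a ((T ^^ i) x))" for x
  note sm = orbit_series_bounded(1)[OF T w a]
  define C where "C = (\<Sum>i. geom_coeff (Suc m) i * cmod w ^ i) * K"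
  have Fb: "cmod (F x) \<le> C * norm x" for x
    unfolding F_def C_def by (rule orbit_series_bounded(2)[OF T w a])
  have Feq: "F x - w * F (T x) = f x - w * f (T x)" for x
  proof -
    have 1: "F x = a x + (\<Sum>i. of_real (geom_coeff (Suc m) (Suc i)) * w ^ Suc i * a ((T ^^ Suc i) x))"
      unfolding F_def using suminf_split_head[OF sm[of "Suc m" x]] by (simp add: geom_coeff_at_0)
    have 2: "w * F (T x) = (\<Sum>i. of_real (geom_coeff (Suc m) i) * w ^ Suc i * a ((T ^^ Suc i) x))"
      unfolding F_def using suminf_mult[OF sm[of "Suc m" "T x"], of w]
      by (simp add: funpow_swap1 mult_ac)
    have 3: "summable (\<lambda>i. of_real (geom_coeff (Suc m) (Suc i)) * w ^ Suc i * a ((T ^^ Suc i) x))"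
      using sm[of "Suc m" x] by (subst summable_Suc_iff)
    have 4: "summable (\<lambda>i. of_real (geom_coeff (Suc m) i) * w ^ Suc i * a ((T ^^ Suc i) x))"
      using summable_mult[OF sm[of "Suc m" "T x"], of w] by (simp add: funpow_swap1 mult_ac)
    have "F x - w * F (T x) = a x +
        (\<Sum>i. of_real (geom_coeff (Suc m) (Suc i)) * w ^ Suc i * a ((T ^^ Suc i) x) -
              of_real (geom_coeff (Suc m) i) * w ^ Suc i * a ((T ^^ Suc i) x))"
      unfolding 1 2 suminf_diff[OF 3 4, symmetric] by (rule add_diff_eq[symmetric])
    \<comment> \<open>Consecutive coefficients of order m + 1 differ by one of order m, matching
      multiplication by 1 - t.\<close>
    also have "\<dots> = a x + (\<Sum>i. of_real (geom_coeff m (Suc i)) * w ^ Suc i * a ((T ^^ Suc i) x))"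
      by (simp add: algebra_simps)
    also have "\<dots> = (\<Sum>i. of_real (geom_coeff m i) * w ^ i * a ((T ^^ i) x))"
      using suminf_split_head[OF sm[of m x]] by (simp add: geom_coeff_at_0)
    also have "\<dots> = f x - w * f (T x)"
      using eq[of x] by (rule sums_unique[symmetric])
    finally show ?thesis .
  qed
  define G where "G x = f x - F x" for x
  \<comment> \<open>The difference of the two solutions satisfies the homogeneous equation;
    iterating it along the bounded orbit gains a factor w^N tending to 0.\<close>
  have Gw: "G x = w ^ N * G ((T ^^ N) x)" for N
  proof (induction N)
    case (Suc N)
    have "G y = w * G (T y)" for y using Feq[of y] by (simp add: G_def algebra_simps)
    then show ?case using Suc by (metis funpow.simps(2) comp_apply power_Suc2 mult.assoc)
  qed simp
  have Gb: "cmod (G y) \<le> \<bar>L + C\<bar> * norm y" for y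
  proof -
    have "cmod (G y) \<le> (L + C) * norm y"
      unfolding G_def using norm_triangle_ineq4[of "f y" "F y"] f[of y] Fb[of y]
      by (simp add: distrib_right)
    also have "\<dots> \<le> \<bar>L + C\<bar> * norm y" by (intro mult_right_mono) auto
    finally show ?thesis .
  qed
  have orb: "norm ((T ^^ i) x) \<le> norm x" for i
    by (induction i) (auto intro: order_trans[OF T])
  have "cmod (G x) \<le> cmod w ^ N * (\<bar>L + C\<bar> * norm x)" for N
  proof -
    have "cmod (G x) = cmod w ^ N * cmod (G ((T ^^ N) x))"
      by (subst Gw[of N]) (simp add: norm_mult norm_power)
    also have "\<dots> \<le> cmod w ^ N * (\<bar>L + C\<bar> * norm x)"
      by (intro mult_left_mono order_trans[OF Gb] orb) auto
    finally show ?thesis .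
  qed
  moreover have "(\<lambda>N. cmod w ^ N * (\<bar>L + C\<bar> * norm x)) \<longlonglongrightarrow> 0"
    using tendsto_mult_left_zero[OF LIMSEQ_power_zero[of "cmod w"]] w by simp
  ultimately have "cmod (G x) \<le> 0"
    by (intro LIMSEQ_le_const) auto
  then have "f x = F x" by (simp add: G_def)
  then show ?thesis
    using summable_sums[OF sm[of "Suc m" x]] by (simp add: F_def)
qed

text \<open>For an eigenvector u the recursion expresses order k + 1 through order k at x and at T
  x. Solving it n times descends from order n, known by assumption, to order 0, the inner product;
  each solution raises the coefficients from m to m + 1.\<close>

lemma eigenvector_orbit_expansion:
  fixes T :: "'a::chilbert_space \<Rightarrow> 'a"
  assumes T: "bounded_linear T" and TC: "\<And>a x. T (a *\<^sub>C x) = a *\<^sub>C T x"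
    and contr: "\<And>x. norm (T x) \<le> norm x" and w: "cmod w < 1" and u: "T u = w *\<^sub>C u"
    and c: "\<And>x. defect_form T n u x = c * cinner e x"
  shows "(\<lambda>i. of_real (geom_coeff n i) * w ^ i * (c * cinner e ((T ^^ i) x))) sums cinner u x"
proof -
  have rec: "defect_form T (Suc k) u x = defect_form T k u x - w * defect_form T k u (T x)" for k x
    by (simp add: defect_form_Suc u defect_form_sesquilinear(2)[OF T TC])
  \<comment> \<open>A linear bound of any size is enough for the uniqueness part of
    \<open>orbit_series_step\<close>.\<close>
  have bnd: "\<exists>L. \<forall>x. cmod (defect_form T k u x) \<le> L * norm x" for k
  proof (induction k)
    case 0
    show ?case using cinner_cauchy_schwarz[of u] by auto
  next
    case (Suc k)
    then obtain L where L: "\<And>x. cmod (defect_form T k u x) \<le> L * norm x" by blast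
    have "cmod (defect_form T (Suc k) u x) \<le> (L + \<bar>L\<bar>) * norm x" for x
    proof -
      have "cmod (w * defect_form T k u (T x)) \<le> 1 * (\<bar>L\<bar> * norm x)"
        unfolding norm_mult
      proof (rule mult_mono)
        have "cmod (defect_form T k u (T x)) \<le> \<bar>L\<bar> * norm (T x)"
          using order_trans[OF L mult_right_mono[OF abs_ge_self norm_ge_zero]] .
        also have "\<dots> \<le> \<bar>L\<bar> * norm x" by (intro mult_left_mono contr) auto
        finally show "cmod (defect_form T k u (T x)) \<le> \<bar>L\<bar> * norm x" .
      qed (use w in auto)
      then show ?thesis
        unfolding rec using norm_triangle_ineq4[of "defect_form T k u x" "w * defect_form T k u (T x)"] L[of x]
        by (simp add: distrib_right)
    qed
    then show ?case by blast
  qed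
  have a: "cmod (c * cinner e x) \<le> (cmod c * norm e) * norm x" for x
    using mult_left_mono[OF cinner_cauchy_schwarz[of e x], of "cmod c"]
    by (simp add: norm_mult mult.assoc)
  have "m \<le> n \<Longrightarrow> (\<lambda>i. of_real (geom_coeff m i) * w ^ i * (c * cinner e ((T ^^ i) x)))
      sums defect_form T (n - m) u x" for m x
  proof (induction m arbitrary: x)
    case 0
    have "(\<lambda>i. of_real (geom_coeff 0 i) * w ^ i * (c * cinner e ((T ^^ i) x))) sums
        (\<Sum>i\<in>{0}. of_real (geom_coeff 0 i) * w ^ i * (c * cinner e ((T ^^ i) x)))"
      by (rule sums_finite) auto
    then show ?case by (simp add: c)
  next
    case (Suc m)
    obtain L where L: "\<And>x. cmod (defect_form T (n - Suc m) u x) \<le> L * norm x"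
      using bnd by blast
    have "n - m = Suc (n - Suc m)" using Suc.prems by simp
    then show ?case
      using Suc by (intro orbit_series_step[OF contr w a L]) (simp add: rec)
  qed
  from this[of n x] show ?thesis by simp
qed

text \<open>A power series with a nonzero coefficient has isolated zeros near 0; the case w = 0
  handles the constant term.\<close>

lemma powser_zero_coeffs:
  fixes a :: "nat \<Rightarrow> complex"
  assumes "\<And>w. cmod w < 1 \<Longrightarrow> (\<lambda>i. a i * w ^ i) sums 0"
  shows "a i = 0"
proof (rule ccontr)
  assume nz: "a i \<noteq> 0"
  have "a 0 = 0" using assms[of 0] by simp
  with nz have "i > 0" by (metis gr0I)
  show False
  proof (rule powser_0_nonzero[of 1 0 a "\<lambda>_. 0" i])
    fix s :: real
    assume "0 < s" and s: "\<And>z. (z::complex) \<in> cball 0 s - {0} \<Longrightarrow> (0::complex) \<noteq> 0"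
    then show False using s[of "of_real s"] by simp
  qed (use assms nz \<open>i > 0\<close> in auto)
qed

section \<open>The orthogonal complement reduces the operator\<close>

lemma closed_csubspace_orthogonal:
  fixes M :: "'a::complex_inner set"
  shows "closed_csubspace {x. \<forall>m\<in>M. cinner m x = 0}"
  unfolding closed_csubspace_def
proof
  show "cvec.subspace {x. \<forall>m\<in>M. cinner m x = 0}"
    by (auto simp: cvec.subspace_def cinner_simps)
  have "closed {x. cinner m x = 0}" for m :: 'a
    by (intro closed_Collect_eq continuous_on_const
        linear_continuous_on bounded_bilinear.bounded_linear_right[OF bounded_bilinear_cinner])
  then have "closed (\<Inter>m\<in>M. {x. cinner m x = 0})" by blast
  then show "closed {x. \<forall>m\<in>M. cinner m x = 0}"
    by (simp add: Collect_ball_eq)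
qed

lemma orthogonal_span_closure:
  fixes y :: "'a::complex_inner"
  assumes "\<And>m. m \<in> E \<Longrightarrow> cinner m y = 0" and "m \<in> closure (cvec.span E)"
  shows "cinner m y = 0"
proof -
  have "closed_csubspace {x. \<forall>m\<in>{y}. cinner m x = 0}" by (rule closed_csubspace_orthogonal)
  moreover have "cinner x y = 0 \<longleftrightarrow> cinner y x = 0" for x :: 'a
    by (metis cinner_commute complex_cnj_zero)
  ultimately have K: "closed_csubspace {x. cinner x y = 0}" by simp
  then have "cvec.span E \<subseteq> {x. cinner x y = 0}"
    using assms(1) by (intro cvec.span_minimal) (auto simp: closed_csubspace_def)
  then have "closure (cvec.span E) \<subseteq> {x. cinner x y = 0}"
    using K by (intro closure_minimal) (auto simp: closed_csubspace_def)
  then show ?thesis using assms(2) by blast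
qed

lemma orthogonal_complement_invariant:
  fixes T :: "'a::chilbert_space \<Rightarrow> 'a"
  assumes T: "bounded_linear T" and TC: "\<And>a x. T (a *\<^sub>C x) = a *\<^sub>C T x"
    and n: "1 \<le> n" and h: "hypercontraction n T" and B1: "cowen_douglas_B1 M T"
    and curv: "\<And>z. z \<in> ball 0 1 \<Longrightarrow> curvature M T z = - of_nat n / of_real ((1 - (cmod z)\<^sup>2)\<^sup>2)"
    and x: "\<And>m. m \<in> M \<Longrightarrow> cinner m x = 0" and m: "m \<in> M"
  shows "cinner m (T x) = 0"
proof -
  have psd: "psd_form (defect_form T n)"
    using psd_form_defect_form[OF T TC h n] by simp
  note contr = hypercontraction_imp_contraction[OF T TC h n]
  have dim: "cvec.dim (eigenspace M T z) = 1" if "z \<in> ball 0 1" for z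
    using B1 that by (simp add: cowen_douglas_B1_def)
  have zero_ball: "(0::complex) \<in> ball 0 1" by simp
  obtain e where e: "e \<in> eigenspace M T 0" "\<And>u. u \<in> eigenspace M T 0 \<Longrightarrow> \<exists>c. u = c *\<^sub>C e"
    using dim_1_generator[OF dim[OF zero_ball]] by blast
  have Te: "T e = 0" using e(1) by (simp add: eigenspace_def)
  have prop_e: "\<exists>c. \<forall>y. defect_form T n u y = c * cinner e y"
    if "w \<in> ball 0 1" "u \<in> eigenspace M T w" for w u
    by (rule defect_form_eigenvectors_proportional[OF T TC psd B1 _ _ Te that]) (fact curv e(2))+
  have expand: "\<exists>c. (u \<noteq> 0 \<longrightarrow> c \<noteq> 0) \<and>
      (\<forall>y. (\<lambda>i. of_real (geom_coeff n i) * w ^ i * (c * cinner e ((T ^^ i) y))) sums cinner u y)"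
    if w: "w \<in> ball 0 1" and u: "u \<in> eigenspace M T w" for w u
  proof -
    obtain c where c: "\<And>y. defect_form T n u y = c * cinner e y"
      using prop_e[OF w u] by blast
    have Tu: "T u = w *\<^sub>C u" using u by (simp add: eigenspace_def)
    have w1: "cmod w < 1" using w by simp
    then have "1 - w * cnj w \<noteq> 0"
      by (rule one_minus_norm_square_nonzero)
    \<comment> \<open>Q(u, u) is a nonzero multiple of <u, u>, so c = 0 would force u = 0.\<close>
    then have "u \<noteq> 0 \<longrightarrow> c \<noteq> 0"
      using c[of u] defect_form_eigenvector[OF T TC Tu, of n] by auto
    then show ?thesis
      using eigenvector_orbit_expansion[OF T TC contr w1 Tu c] by blast
  qed
  have orbit: "cinner e ((T ^^ i) x) = 0" for i
  proof -
    \<comment> \<open>Since x is orthogonal to M, <u, x> = 0. Dividing by c, which varies with w,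
      leaves coefficients independent of w.\<close>
    have "(\<lambda>i. (of_real (geom_coeff n i) * cinner e ((T ^^ i) x)) * w ^ i) sums 0" if "cmod w < 1" for w
    proof -
      have w: "w \<in> ball 0 1" using that by simp
      obtain u where u: "u \<in> eigenspace M T w" "u \<noteq> 0"
        using dim_1_generator[OF dim[OF w]] by metis
      obtain c where c: "c \<noteq> 0"
        "(\<lambda>i. of_real (geom_coeff n i) * w ^ i * (c * cinner e ((T ^^ i) x))) sums cinner u x"
        using expand[OF w u(1)] u(2) by blast
      have "cinner u x = 0" using x u(1) by (simp add: eigenspace_def)
      then show ?thesis
        using sums_mult[OF c(2), of "1 / c"] c(1) by (simp add: mult_ac)
    qed
    then have "of_real (geom_coeff n i) * cinner e ((T ^^ i) x) = 0"
      by (rule powser_zero_coeffs)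
    then show ?thesis using geom_coeff_pos[OF n, of i] by simp
  qed
  have "cinner u (T x) = 0" if u: "u \<in> (\<Union>w\<in>ball 0 1. eigenspace M T w)" for u
  proof -
    obtain w c where
      "(\<lambda>i. of_real (geom_coeff n i) * w ^ i * (c * cinner e ((T ^^ i) (T x)))) sums cinner u (T x)"
      using expand u by blast
    \<comment> \<open>The expansion at T x uses the same orbit numbers, shifted by one.\<close>
    moreover have "cinner e ((T ^^ i) (T x)) = 0" for i
      using orbit[of "Suc i"] by (simp add: funpow_swap1)
    ultimately show ?thesis using sums_unique2[OF _ sums_zero] by fastforce
  qed
  then show ?thesis
    using orthogonal_span_closure[of "\<Union>w\<in>ball 0 1. eigenspace M T w" "T x" m] m B1
    by (auto simp: cowen_douglas_B1_def)
qed

theorem theorem4p14: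
  fixes T :: "'a::chilbert_space \<Rightarrow> 'a" and n :: nat
  assumes separable: "separable_space (euclidean :: 'a topology)"
    and infinite_dimensional: "\<nexists>B :: 'a set. finite B \<and> cvec.span B = UNIV"
    and bounded: "bounded_operator_on UNIV T"
    and "n \<ge> 1"
    and "hypercontraction n T"
    and "\<exists>M \<in> Lat T. M \<noteq> UNIV \<and> cowen_douglas_B1 M T \<and>
           (\<forall>\<omega>\<in>ball 0 1. curvature M T \<omega> = - of_nat n / of_real ((1 - (cmod \<omega>)\<^sup>2)\<^sup>2))"
  shows "reducible T"
proof -
  obtain M where M: "closed_csubspace M" "T ` M \<subseteq> M" "M \<noteq> UNIV" and B1: "cowen_douglas_B1 M T"
    and curv: "\<And>\<omega>. \<omega> \<in> ball 0 1 \<Longrightarrow> curvature M T \<omega> = - of_nat n / of_real ((1 - (cmod \<omega>)\<^sup>2)\<^sup>2)"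
    using assms(6) unfolding Lat_def by blast
  have TC: "T (a *\<^sub>C x) = a *\<^sub>C T x" for a x
    using bounded by (simp add: bounded_operator_on_def)
  obtain K where K: "\<And>x. norm (T x) \<le> K * norm x"
    using bounded by (auto simp: bounded_operator_on_def)
  have T: "bounded_linear T"
  proof (rule bounded_linear_intro)
    show "T (x + y) = T x + T y" for x y using bounded by (simp add: bounded_operator_on_def)
    show "norm (T x) \<le> norm x * K" for x using K[of x] by (simp add: mult.commute)
  qed (simp add: scaleR_scaleC TC)
  define N where "N = {x. \<forall>m\<in>M. cinner m x = 0}"
  have "closed_csubspace N" unfolding N_def by (rule closed_csubspace_orthogonal)
  \<comment> \<open>Here M is proper, so a vector outside M has a nonzero component orthogonal to
    it.\<close>
  moreover have "N \<noteq> {0}"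
  proof -
    obtain x where "x \<notin> M" using M(3) by blast
    then obtain y where "y \<noteq> 0" "\<And>m. m \<in> M \<Longrightarrow> cinner m y = 0"
      using orthogonal_vector_exists[OF M(1)] by blast
    then show ?thesis unfolding N_def by blast
  qed
  moreover have "N \<noteq> UNIV"
  proof -
    have dim: "cvec.dim (eigenspace M T 0) = 1" using B1 by (simp add: cowen_douglas_B1_def)
    obtain e where "e \<in> eigenspace M T 0" "e \<noteq> 0"
 using dim_1_generator[OF dim] by metis
    then have "e \<in> M" by (simp add: eigenspace_def)
    with \<open>e \<noteq> 0\<close> have "e \<notin> N" unfolding N_def using cinner_self_eq_0 by blast
    then show ?thesis by blast
  qed
  moreover have "T ` N \<subseteq> N"
    unfolding N_def using orthogonal_complement_invariant[OF T TC assms(4,5) B1 curv] by blast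
  \<comment> \<open>By <m, \<open>cadjoint T x\<close>> = <T m, x>, invariance of M under T passes
    to invariance of N under the adjoint.\<close>
  moreover have "cadjoint T ` N \<subseteq> N"
    using M(2) by (auto simp: N_def cadjoint[OF T TC, symmetric])
  ultimately show ?thesis
    unfolding reducible_def by blast
qed

end
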